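(* Let $\mathsf{L}=\mathsf{a}(x)\frac{d^2}{dx^2}+\mathsf{b}(x)\frac{d}{dx}$ be a one-dimensional diffusion process generator in an interval $(l,r)$ with inaccessible boundary points, with $\mathsf{a},\mathsf{b}\in C^\infty$ and $\mathsf{a}>0$ on $(l,r)$, with positive increasing eigenfunctions $\psi_\lambda$, and satisfying conditions (BC) and (AO) (see context). Let $0\le\lambda_1<\lambda_2<\dots<\lambda_N$ and let $\mathsf{x}_i^{\lambda_i}$, $i=1,\dots,N$, be independent $\mathsf{L}^{\psi_{\lambda_i}}$-diffusions starting from $(\mathsf{x}_1^{\lambda_1}(0),\dots,\mathsf{x}_N^{\lambda_N}(0))=x\in\mathbb{W}_N$, where $\mathbb{W}_N=\{x\in(l,r)^N:x_1<\dots<x_N\}$. Let $\tau_C=\inf\{t\ge0:(\mathsf{x}_1^{\lambda_1}(t),\dots,\mathsf{x}_N^{\lambda_N}(t))\notin\mathbb{W}_N\}$. Then the probability that these diffusions never collide is $$\mathbb{P}_x(\tau_C=\infty)=\frac{\det\left(\psi_{\lambda_i}(x_j)\right)_{i,j=1}^N}{\prod_{i=1}^N\psi_{\lambda_i}(x_i)}.$$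
   Context: The boundary points $l,r$ are inaccessible for the $\mathsf{L}$-diffusion (each is natural or entrance in Feller's classification). $p_t(x,y)$ is the transition density of the $\mathsf{L}$-diffusion with respect to Lebesgue measure. For $\lambda>0$, $\psi_\lambda$ is the strictly positive increasing solution of $\mathsf{L}\psi_\lambda=\lambda\psi_\lambda$ on $(l,r)$ with the usual boundary conditions of one-dimensional diffusion theory, unique up to a multiplicative constant which is fixed arbitrarily; $\psi_0\equiv1$. The $\mathsf{L}^{\psi_\lambda}$-diffusion is the Doob $h$-transform with generator $$\mathsf{L}^{\psi_\lambda}=\mathsf{a}(x)\frac{d^2}{dx^2}+\left(\mathsf{b}(x)+2\mathsf{a}(x)\frac{\psi_\lambda'(x)}{\psi_\lambda(x)}\right)\frac{d}{dx},\qquad \mathsf{L}^{\psi_0}=\mathsf{L},$$ and transition density $p_t^{\psi_\lambda}(x,y)=e^{-\lambda t}\frac{\psi_\lambda(y)}{\psi_\lambda(x)}p_t(x,y)$. Condition (BC): for all $\lambda\ge0$ the boundary points $l$ and $r$ are inaccessible for the $\mathsf{L}^{\psi_\lambda}$-diffusion (in particular $p_t^{\psi_\lambda}(x,\cdot)$ integrates to $1$ over $(l,r)$). Condition (AO): whenever $\lambda_1<\lambda_2$ and $\mathsf{x}_1^{\lambda_1},\mathsf{x}_2^{\lambda_2}$ are independent $\mathsf{L}^{\psi_{\lambda_1}}$- and $\mathsf{L}^{\psi_{\lambda_2}}$-diffusions started from arbitrary $x_1,x_2\in(l,r)$ (not necessarily ordered), $\mathbb{P}_{(x_1,x_2)}(\mathsf{x}_1^{\lambda_1}(t)<\mathsf{x}_2^{\lambda_2}(t))\to1$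 as $t\to\infty$. *)

theory Defs
  imports "HOL-Probability.Probability"
begin

section \<open>Generators and boundary classification\<close>

text \<open>The open interval \<open>(l,r)\<close> with possibly infinite endpoints is \<^term>\<open>einterval l r\<close>.
  It is open, so smoothness on it can be expressed with iterated derivatives at points.\<close>

definition smooth_on :: "real set \<Rightarrow> (real \<Rightarrow> real) \<Rightarrow> bool" where
  "smooth_on S f \<longleftrightarrow> (\<forall>n. \<forall>x\<in>S. (deriv ^^ n) f field_differentiable (at x))"

definition generator :: "(real \<Rightarrow> real) \<Rightarrow> (real \<Rightarrow> real) \<Rightarrow> (real \<Rightarrow> real) \<Rightarrow> real \<Rightarrow> real" where
  "generator a b f x = a x * deriv (deriv f) x + b x * deriv f x"

text \<open>Densities of the scale function and of the speed measure of \<open>a d\<^sup>2/dx\<^sup>2 + b d/dx\<close>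
  (there is no factor 1/2 in front of \<open>a\<close>), normalised at the reference point \<open>c\<close>:
  \<open>generator a b f = (1/m') (f'/s')'\<close>.\<close>

definition scale_density :: "(real \<Rightarrow> real) \<Rightarrow> (real \<Rightarrow> real) \<Rightarrow> real \<Rightarrow> real \<Rightarrow> real" where
  "scale_density a b c x = exp (- (LBINT z=ereal c..ereal x. b z / a z))"

definition speed_density :: "(real \<Rightarrow> real) \<Rightarrow> (real \<Rightarrow> real) \<Rightarrow> real \<Rightarrow> real \<Rightarrow> real" where
  "speed_density a b c x = 1 / (a x * scale_density a b c x)"

text \<open>In Feller's classification a boundary point is inaccessible (natural or entrance) iff the
  integral of the speed measure of \<open>(c,y)\<close> against the scale measure diverges at that point;
  the remaining types (regular and exit) are those for which it converges.
  Divergence does not depend on the interior point \<open>c\<close>.\<close>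

definition inaccessible_right ::
    "ereal \<Rightarrow> ereal \<Rightarrow> (real \<Rightarrow> real) \<Rightarrow> (real \<Rightarrow> real) \<Rightarrow> bool" where
  "inaccessible_right l r a b \<longleftrightarrow> (\<forall>c\<in>einterval l r.
     (\<integral>\<^sup>+y\<in>einterval (ereal c) r. ennreal (scale_density a b c y) *
        (\<integral>\<^sup>+z\<in>{c..y}. ennreal (speed_density a b c z) \<partial>lborel) \<partial>lborel) = \<infinity>)"

definition inaccessible_left ::
    "ereal \<Rightarrow> ereal \<Rightarrow> (real \<Rightarrow> real) \<Rightarrow> (real \<Rightarrow> real) \<Rightarrow> bool" where
  "inaccessible_left l r a b \<longleftrightarrow> (\<forall>c\<in>einterval l r.
     (\<integral>\<^sup>+y\<in>einterval l (ereal c). ennreal (scale_density a b c y) *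
        (\<integral>\<^sup>+z\<in>{y..c}. ennreal (speed_density a b c z) \<partial>lborel) \<partial>lborel) = \<infinity>)"

definition inaccessible_boundaries ::
    "ereal \<Rightarrow> ereal \<Rightarrow> (real \<Rightarrow> real) \<Rightarrow> (real \<Rightarrow> real) \<Rightarrow> bool" where
  "inaccessible_boundaries l r a b \<longleftrightarrow> inaccessible_left l r a b \<and> inaccessible_right l r a b"

section \<open>Diffusion processes\<close>

text \<open>\<open>q t x y\<close> (for \<open>t > 0\<close> and \<open>x, y\<close> in the interval; other values are irrelevant) is the
  transition density with respect to Lebesgue measure, in its continuous version, of the conservative
  Markov semigroup generated by \<open>a d\<^sup>2/dx\<^sup>2 + b d/dx\<close>. The link with the generator is the
  identity \<open>P\<^sub>t f = f + \<integral>\<^sub>0\<^sup>t P\<^sub>s (generator a b f) ds\<close> for smooth \<open>f\<close> with compact support in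
  the interval.\<close>

definition transition_density ::
    "ereal \<Rightarrow> ereal \<Rightarrow> (real \<Rightarrow> real) \<Rightarrow> (real \<Rightarrow> real) \<Rightarrow>
     (real \<Rightarrow> real \<Rightarrow> real \<Rightarrow> real) \<Rightarrow> bool" where
  "transition_density l r a b q \<longleftrightarrow>
     (\<forall>t>0. \<forall>x\<in>einterval l r. \<forall>y\<in>einterval l r. 0 \<le> q t x y) \<and>
     continuous_on ({0<..} \<times> einterval l r \<times> einterval l r) (\<lambda>(t, x, y). q t x y) \<and>
     (\<forall>t>0. \<forall>x\<in>einterval l r. (\<integral>\<^sup>+y\<in>einterval l r. ennreal (q t x y) \<partial>lborel) = 1) \<and>
     (\<forall>s>0. \<forall>t>0. \<forall>x\<in>einterval l r. \<forall>z\<in>einterval l r.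
        (\<integral>\<^sup>+y\<in>einterval l r. ennreal (q s x y * q t y z) \<partial>lborel) = ennreal (q (s + t) x z)) \<and>
     (\<forall>f K. smooth_on UNIV f \<and> compact K \<and> K \<subseteq> einterval l r \<and> (\<forall>x. x \<notin> K \<longrightarrow> f x = 0) \<longrightarrow>
        (\<forall>t>0. \<forall>x\<in>einterval l r.
           (LBINT y:einterval l r. q t x y * f y) =
           f x + (LBINT s=0..ereal t. (LBINT y:einterval l r. q s x y * generator a b f y))))"

text \<open>\<open>X\<close> is a process on \<open>M\<close> with continuous paths in the interval, started at \<open>x\<close>, that is Markov
  for its natural filtration with transition density \<open>q\<close>: the last clause says that, given the
  path up to time \<open>s\<close>, the conditional law of \<open>X (s + t)\<close> has density \<open>q t (X s)\<close>.\<close>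

definition markov_process ::
    "ereal \<Rightarrow> ereal \<Rightarrow> (real \<Rightarrow> real \<Rightarrow> real \<Rightarrow> real) \<Rightarrow>
     'w measure \<Rightarrow> (real \<Rightarrow> 'w \<Rightarrow> real) \<Rightarrow> real \<Rightarrow> bool" where
  "markov_process l r q M X x \<longleftrightarrow>
     prob_space M \<and>
     (\<forall>t\<ge>0. X t \<in> borel_measurable M) \<and>
     (\<forall>\<omega>\<in>space M. X 0 \<omega> = x \<and> continuous_on {0..} (\<lambda>t. X t \<omega>) \<and>
        (\<forall>t\<ge>0. X t \<omega> \<in> einterval l r)) \<and>
     (\<forall>s\<ge>0. \<forall>t>0. \<forall>E\<in>sets (\<Pi>\<^sub>M u\<in>{0..s}. (borel :: real measure)). \<forall>B\<in>sets (borel :: real measure).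
        emeasure M {\<omega>\<in>space M. (\<lambda>u\<in>{0..s}. X u \<omega>) \<in> E \<and> X (s + t) \<omega> \<in> B} =
        (\<integral>\<^sup>+\<omega>\<in>{\<omega>\<in>space M. (\<lambda>u\<in>{0..s}. X u \<omega>) \<in> E}.
           (\<integral>\<^sup>+y\<in>B \<inter> einterval l r. ennreal (q t (X s \<omega>) y) \<partial>lborel) \<partial>M))"

text \<open>The diffusion with generator \<open>a d\<^sup>2/dx\<^sup>2 + b d/dx\<close> and transition density \<open>q\<close>,
  started at \<open>x\<close>.\<close>

definition diffusion ::
    "ereal \<Rightarrow> ereal \<Rightarrow> (real \<Rightarrow> real) \<Rightarrow> (real \<Rightarrow> real) \<Rightarrow> (real \<Rightarrow> real \<Rightarrow> real \<Rightarrow> real) \<Rightarrow>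
     'w measure \<Rightarrow> (real \<Rightarrow> 'w \<Rightarrow> real) \<Rightarrow> real \<Rightarrow> bool" where
  "diffusion l r a b q M X x \<longleftrightarrow>
     x \<in> einterval l r \<and> transition_density l r a b q \<and> markov_process l r q M X x"

section \<open>Increasing eigenfunctions and Doob transforms\<close>

text \<open>The last clause, a vanishing derivative with respect to scale at \<open>l\<close>, is the usual boundary
  condition for the increasing solution; it holds automatically when \<open>l\<close> is inaccessible.
  The limit is taken in \<^typ>\<open>ereal\<close> because \<open>l\<close> may be infinite.\<close>

definition increasing_eigenfunction ::
    "ereal \<Rightarrow> ereal \<Rightarrow> (real \<Rightarrow> real) \<Rightarrow> (real \<Rightarrow> real) \<Rightarrow> real \<Rightarrow> (real \<Rightarrow> real) \<Rightarrow> bool" where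
  "increasing_eigenfunction l r a b lam \<psi> \<longleftrightarrow>
     (\<forall>x\<in>einterval l r. 0 < \<psi> x) \<and>
     strict_mono_on (einterval l r) \<psi> \<and>
     (\<forall>x\<in>einterval l r. \<psi> field_differentiable (at x) \<and> deriv \<psi> field_differentiable (at x) \<and>
        generator a b \<psi> x = lam * \<psi> x) \<and>
     (\<forall>c\<in>einterval l r.
        (((\<lambda>x. deriv \<psi> x / scale_density a b c x) \<circ> real_of_ereal) \<longlongrightarrow> 0) (at_right l))"

definition doob_drift ::
    "(real \<Rightarrow> real) \<Rightarrow> (real \<Rightarrow> real) \<Rightarrow> (real \<Rightarrow> real) \<Rightarrow> real \<Rightarrow> real" where
  "doob_drift a b \<psi> x = b x + 2 * a x * (deriv \<psi> x / \<psi> x)"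

definition doob_density ::
    "(real \<Rightarrow> real \<Rightarrow> real \<Rightarrow> real) \<Rightarrow> real \<Rightarrow> (real \<Rightarrow> real) \<Rightarrow> real \<Rightarrow> real \<Rightarrow> real \<Rightarrow> real" where
  "doob_density p lam \<psi> t x y = exp (- lam * t) * (\<psi> y / \<psi> x) * p t x y"

definition doob_diffusion ::
    "ereal \<Rightarrow> ereal \<Rightarrow> (real \<Rightarrow> real) \<Rightarrow> (real \<Rightarrow> real) \<Rightarrow> (real \<Rightarrow> real \<Rightarrow> real \<Rightarrow> real) \<Rightarrow>
     (real \<Rightarrow> real \<Rightarrow> real) \<Rightarrow> real \<Rightarrow> 'w measure \<Rightarrow> (real \<Rightarrow> 'w \<Rightarrow> real) \<Rightarrow> real \<Rightarrow> bool" where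
  "doob_diffusion l r a b p \<psi> lam M X x \<longleftrightarrow>
     diffusion l r a (doob_drift a b (\<psi> lam)) (doob_density p lam (\<psi> lam)) M X x"

text \<open>\<open>P\<close> is the law, on a space of paths, of the \<open>lam\<close>-transformed diffusion started at \<open>x\<close>:
  under \<open>P\<close> the coordinate process is that diffusion.\<close>

definition doob_path_law ::
    "ereal \<Rightarrow> ereal \<Rightarrow> (real \<Rightarrow> real) \<Rightarrow> (real \<Rightarrow> real) \<Rightarrow> (real \<Rightarrow> real \<Rightarrow> real \<Rightarrow> real) \<Rightarrow>
     (real \<Rightarrow> real \<Rightarrow> real) \<Rightarrow> real \<Rightarrow> real \<Rightarrow> (real \<Rightarrow> real) measure \<Rightarrow> bool" where
  "doob_path_law l r a b p \<psi> lam x P \<longleftrightarrow> doob_diffusion l r a b p \<psi> lam P (\<lambda>t w. w t) x"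

definition condition_BC ::
    "ereal \<Rightarrow> ereal \<Rightarrow> (real \<Rightarrow> real) \<Rightarrow> (real \<Rightarrow> real) \<Rightarrow> (real \<Rightarrow> real \<Rightarrow> real) \<Rightarrow> bool" where
  "condition_BC l r a b \<psi> \<longleftrightarrow>
     (\<forall>lam\<ge>0. inaccessible_boundaries l r a (doob_drift a b (\<psi> lam)))"

text \<open>Independent diffusions are realised as the two coordinates under the product of their path
  laws.\<close>

definition condition_AO ::
    "ereal \<Rightarrow> ereal \<Rightarrow> (real \<Rightarrow> real) \<Rightarrow> (real \<Rightarrow> real) \<Rightarrow> (real \<Rightarrow> real \<Rightarrow> real \<Rightarrow> real) \<Rightarrow>
     (real \<Rightarrow> real \<Rightarrow> real) \<Rightarrow> bool" where
  "condition_AO l r a b p \<psi> \<longleftrightarrow>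
     (\<forall>lam1 lam2 x1 x2 P1 P2.
        0 \<le> lam1 \<and> lam1 < lam2 \<and> x1 \<in> einterval l r \<and> x2 \<in> einterval l r \<and>
        doob_path_law l r a b p \<psi> lam1 x1 P1 \<and> doob_path_law l r a b p \<psi> lam2 x2 P2 \<longrightarrow>
        ((\<lambda>t. measure (P1 \<Otimes>\<^sub>M P2) {(w1, w2) \<in> space (P1 \<Otimes>\<^sub>M P2). w1 t < w2 t}) \<longlongrightarrow> 1) at_top)"

section \<open>Collisions\<close>

text \<open>The index set \<open>{1..N}\<close> is an arbitrary nonempty finite linearly ordered type.\<close>

definition weyl_chamber :: "ereal \<Rightarrow> ereal \<Rightarrow> (real ^ 'n::{finite,linorder}) set" where
  "weyl_chamber l r = {x. (\<forall>i. x $ i \<in> einterval l r) \<and> (\<forall>i j. i < j \<longrightarrow> x $ i < x $ j)}"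

definition collision_time ::
    "ereal \<Rightarrow> ereal \<Rightarrow> ('n::{finite,linorder} \<Rightarrow> real \<Rightarrow> 'w \<Rightarrow> real) \<Rightarrow> 'w \<Rightarrow> ereal" where
  "collision_time l r X \<omega> = Inf {ereal t |t. 0 \<le> t \<and> (\<chi> i. X i t \<omega>) \<notin> weyl_chamber l r}"

end

theory Submission
  imports Defs
begin

text \<open>For a permutation \<open>\<sigma>\<close> the positive process
  \<open>R\<^sub>\<sigma>(t) = \<Prod>\<^sub>k \<psi>\<^bsub>lam (\<sigma> k)\<^esub>(X\<^sub>k(t)) / \<psi>\<^bsub>lam k\<^esub>(X\<^sub>k(t))\<close> is a martingale: it changes the parameters
  of the independent Doob transforms from \<open>lam k\<close> to \<open>lam (\<sigma> k)\<close>, and the exponential factors cancel.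
  The signed sum of the \<open>R\<^sub>\<sigma>\<close> is the quotient \<open>det (\<psi>\<^bsub>lam i\<^esub>(X\<^sub>j)) / \<Prod>\<^sub>i \<psi>\<^bsub>lam i\<^esub>(X\<^sub>i)\<close>, a continuous
  martingale that vanishes at the first collision. Its initial value therefore equals its
  expectation on the event that no collision occurs before time \<open>t\<close>. As \<open>t\<close> tends to infinity, only
  the term \<open>R\<^bsub>id\<^esub> = 1\<close> survives: if \<open>\<sigma> \<noteq> id\<close>, there are \<open>i < j\<close> with \<open>\<sigma> j < \<sigma> i\<close>, and under the changed
  measure the \<open>i\<close>-th diffusion has the larger parameter and, by (AO), lies above the \<open>j\<close>-th
  with probability tending to \<open>1\<close>.\<close>

section \<open>Martingales vanishing at a random time\<close>

text \<open>The ratios are unbounded and no uniform integrability is assumed, so optional stopping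
  at the first collision is carried out on refining time grids up to a fixed \<open>t\<close>. The
  martingale identity is needed for events of the joint past, since a collision involves two paths;
  independence gives it on boxes, and boxes generate. A single ratio is a martingale only up to a
  factor \<open>exp ((\<mu> - \<kappa>) * u)\<close>; in the product the exponents sum to zero
  because a permutation preserves the sum of the parameters. The long-time limit needs no change of
  measure on whole paths: without a collision up to \<open>t\<close> the \<open>i\<close>-th path is
  below the \<open>j\<close>-th at the single time \<open>t\<close>, so one-time marginals suffice.
  In that use of (AO) the diffusion with the larger parameter starts from the smaller point
  \<open>x $ i\<close>; this is where the freedom of unordered starting points enters.\<close>

text \<open>Optional stopping at the time \<tau> at which \<open>C\<close> occurs, with
  \<open>C u\<close> in the role of the event \<tau> \<le> u. Rounded up to a grid, \<tau> takes
  finitely many values, and the martingale identity on each piece trades \<open>d\<close> at the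
  grid time for \<open>d t\<close>. As the mesh shrinks, path continuity sends \<open>d\<close> at
  the grid time to \<open>d\<close> at \<tau>, which is 0.\<close>

lemma (in prob_space) stopped_martingale_zero:
  fixes d :: "real \<Rightarrow> 'a \<Rightarrow> real" and F :: "real \<Rightarrow> 'a measure" and C :: "real \<Rightarrow> 'a set"
  assumes t: "0 < t"
    and space_F: "\<And>s. 0 \<le> s \<Longrightarrow> s \<le> t \<Longrightarrow> space (F s) = space M"
    and sets_F: "\<And>s. 0 \<le> s \<Longrightarrow> s \<le> t \<Longrightarrow> sets (F s) \<subseteq> sets M"
    and C: "\<And>u s. 0 \<le> u \<Longrightarrow> u \<le> s \<Longrightarrow> s \<le> t \<Longrightarrow> C u \<in> sets (F s)"
    and adapted: "\<And>s. 0 \<le> s \<Longrightarrow> s \<le> t \<Longrightarrow> d s \<in> borel_measurable (F s)"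
    and integrable: "\<And>s. 0 \<le> s \<Longrightarrow> s \<le> t \<Longrightarrow> integrable M (d s)"
    and martingale: "\<And>s A. 0 \<le> s \<Longrightarrow> s \<le> t \<Longrightarrow> A \<in> sets (F s) \<Longrightarrow>
          (\<integral>\<omega>. indicator A \<omega> * d s \<omega> \<partial>M) = (\<integral>\<omega>. indicator A \<omega> * d t \<omega> \<partial>M)"
    and cont: "\<And>\<omega>. \<omega> \<in> space M \<Longrightarrow> continuous_on {0..t} (\<lambda>s. d s \<omega>)"
    and debut: "\<And>\<omega>. \<omega> \<in> C t \<Longrightarrow>
          \<exists>\<tau>\<in>{0..t}. d \<tau> \<omega> = 0 \<and> (\<forall>u\<in>{0..t}. \<omega> \<in> C u \<longleftrightarrow> \<tau> \<le> u)"
    and mono: "\<And>u. 0 \<le> u \<Longrightarrow> u \<le> t \<Longrightarrow> C u \<subseteq> C t"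
  shows "(\<integral>\<omega>. indicator (C t) \<omega> * d t \<omega> \<partial>M) = 0"
proof -
  \<comment> \<open>The grid of mesh t / (n + 1) has n + 2 points and ends exactly at
    \<open>t\<close>, so on \<open>C t\<close> some grid point lies at or after \<tau>.\<close>
  define g where "g n k = t * real k / real (Suc n)" for n k :: nat
  have g: "0 \<le> g n k" "k \<le> Suc n \<Longrightarrow> g n k \<le> t" for n k
  proof -
    show "0 \<le> g n k" using t by (simp add: g_def)
    assume "k \<le> Suc n"
    then have "t * real k \<le> t * real (Suc n)"
      using t by (intro mult_left_mono) auto
    then show "g n k \<le> t" by (simp add: g_def divide_le_eq)
  qed
  have g_mono: "j \<le> k \<Longrightarrow> g n j \<le> g n k" for n j k
    using t by (auto simp: g_def divide_right_mono)
  \<comment> \<open>Cutting off at \<open>\<bar>d\<bar> \<le> 1\<close> replaces uniform integrability; it is harmless in the limit, where \<open>d\<close> vanishes.\<close>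
  define A where "A n k = {\<omega> \<in> C (g n k). \<bar>d (g n k) \<omega>\<bar> \<le> 1} - (\<Union>j<k. C (g n j))" for n k
  have A: "A n k \<in> sets (F (g n k))" if k: "k \<le> Suc n" for n k
  proof -
    have [measurable]: "d (g n k) \<in> borel_measurable (F (g n k))"
      using adapted g k by auto
    have C1[measurable]: "C (g n j) \<in> sets (F (g n k))" if "j \<le> k" for j
      by (rule C) (use g g_mono that k in auto)
    have "{\<omega> \<in> space (F (g n k)). \<bar>d (g n k) \<omega>\<bar> \<le> 1} \<in> sets (F (g n k))"
      by measurable
    with C1[of k] have "C (g n k) \<inter> {\<omega> \<in> space (F (g n k)). \<bar>d (g n k) \<omega>\<bar> \<le> 1} \<in> sets (F (g n k))"
      by blast
    also have "C (g n k) \<inter> {\<omega> \<in> space (F (g n k)). \<bar>d (g n k) \<omega>\<bar> \<le> 1} =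
        {\<omega> \<in> C (g n k). \<bar>d (g n k) \<omega>\<bar> \<le> 1}"
      using sets.sets_into_space[OF C1[of k]] by auto
    finally show ?thesis
      unfolding A_def by (intro sets.Diff sets.finite_UN) (use C1 in auto)
  qed
  have A_M[measurable]: "A n k \<in> sets M" if "k \<le> Suc n" for n k
    using A[OF that] sets_F[of "g n k"] g that by auto
  have C_M[measurable]: "C t \<in> sets M"
    using C[of t t] sets_F[of t] t by auto
  \<comment> \<open>\<open>Z n\<close> evaluates \<open>d\<close> at the rounded time,
    \<open>V n\<close> puts the terminal value on the same disjoint pieces. Each piece belongs to
    the past of its grid time, so the two have equal expectations.\<close>
  define Z where "Z n \<omega> = (\<Sum>k\<le>Suc n. indicator (A n k) \<omega> * d (g n k) \<omega>)" for n \<omega>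
  define V where "V n \<omega> = (\<Sum>k\<le>Suc n. indicator (A n k) \<omega> * d t \<omega>)" for n \<omega>
  have int_d: "integrable M (\<lambda>\<omega>. indicator (A n k) \<omega> * d s \<omega>)"
    if "k \<le> Suc n" "0 \<le> s" "s \<le> t" for n k s
    using integrable_mult_indicator[OF A_M[OF that(1)] integrable[OF that(2,3)]] by simp
  have ZV: "(\<integral>\<omega>. Z n \<omega> \<partial>M) = (\<integral>\<omega>. V n \<omega> \<partial>M)" for n
    unfolding Z_def V_def using t
    by (subst (1 2) Bochner_Integration.integral_sum)
       (auto intro!: sum.cong martingale A int_d simp: g simp del: sum.atMost_Suc)
  have Z_meas: "Z n \<in> borel_measurable M" for n
    unfolding Z_def using int_d g by (intro borel_measurable_sum) auto
  have V_meas: "V n \<in> borel_measurable M" for n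
    unfolding V_def using int_d[of _ n t] t by (intro borel_measurable_sum) auto
  \<comment> \<open>\<open>\<kappa> n\<close> is the first index of the \<open>n\<close>-th grid at which the event \<open>C\<close> has occurred.\<close>
  have ptw: "\<exists>\<kappa>. (\<forall>n. \<kappa> n \<le> Suc n) \<and> (\<lambda>n. d (g n (\<kappa> n)) \<omega>) \<longlonglongrightarrow> 0 \<and>
     (\<forall>n k. k \<le> Suc n \<longrightarrow> (\<omega> \<in> A n k \<longleftrightarrow> k = \<kappa> n \<and> \<bar>d (g n (\<kappa> n)) \<omega>\<bar> \<le> 1))"
    if \<omega>: "\<omega> \<in> C t" for \<omega>
  proof -
    obtain \<tau> where \<tau>: "0 \<le> \<tau>" "\<tau> \<le> t" "d \<tau> \<omega> = 0"
      and \<tau>_iff: "\<And>u. 0 \<le> u \<Longrightarrow> u \<le> t \<Longrightarrow> \<omega> \<in> C u \<longleftrightarrow> \<tau> \<le> u"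
      using debut[OF \<omega>] by auto
    \<comment> \<open>Solving \<open>\<tau> \<le> g n k\<close> for \<open>k\<close> gives this
      ceiling; rounding up costs at most one mesh, which is the bound \<open>hi\<close>.\<close>
    define \<kappa> where "\<kappa> n = nat \<lceil>\<tau> * real (Suc n) / t\<rceil>" for n
    have \<kappa>_iff: "\<tau> \<le> g n k \<longleftrightarrow> \<kappa> n \<le> k" for n k
    proof -
      have "\<kappa> n \<le> k \<longleftrightarrow> \<tau> * real (Suc n) / t \<le> real k"
        unfolding \<kappa>_def by linarith
      also have "\<dots> \<longleftrightarrow> \<tau> \<le> g n k"
        using t by (simp add: g_def field_simps)
      finally show ?thesis ..
    qed
    have "\<tau> \<le> g n (Suc n)" for n using \<tau> by (simp add: g_def)
    then have \<kappa>_le: "\<kappa> n \<le> Suc n" for n using \<kappa>_iff by blast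
    have lo: "\<tau> \<le> g n (\<kappa> n)" for n using \<kappa>_iff by blast
    have hi: "g n (\<kappa> n) \<le> \<tau> + t / real (Suc n)" for n
    proof -
      have "real (\<kappa> n) \<le> \<tau> * real (Suc n) / t + 1"
        unfolding \<kappa>_def using \<tau> t by (simp add: of_nat_nat)
      from mult_left_mono[OF this, of t] have "t * real (\<kappa> n) \<le> \<tau> * real (Suc n) + t"
        using t by (simp add: distrib_left del: of_nat_Suc)
      then have "t * real (\<kappa> n) / real (Suc n) \<le> (\<tau> * real (Suc n) + t) / real (Suc n)"
        by (intro divide_right_mono) auto
      also have "\<dots> = \<tau> + t / real (Suc n)"
        by (simp add: add_divide_distrib)
      finally show ?thesis unfolding g_def .
    qed
    have "(\<lambda>n. t / real (Suc n)) \<longlonglongrightarrow> 0"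
      using tendsto_mult[OF tendsto_const[of t] LIMSEQ_inverse_real_of_nat] by (simp add: field_simps)
    from tendsto_add[OF tendsto_const[of \<tau>] this]
    have "(\<lambda>n. \<tau> + t / real (Suc n)) \<longlonglongrightarrow> \<tau>" by simp
    then have "(\<lambda>n. g n (\<kappa> n)) \<longlonglongrightarrow> \<tau>"
      by (rule real_tendsto_sandwich[rotated 3]) (use lo hi in auto)
    then have "(\<lambda>n. d (g n (\<kappa> n)) \<omega>) \<longlonglongrightarrow> d \<tau> \<omega>"
      using sets.sets_into_space[OF C_M] \<omega> \<tau> g \<kappa>_le
      by (intro continuous_on_tendsto_compose[OF cont]) auto
    moreover have "\<omega> \<in> A n k \<longleftrightarrow> k = \<kappa> n \<and> \<bar>d (g n (\<kappa> n)) \<omega>\<bar> \<le> 1" if k: "k \<le> Suc n" for n k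
    proof -
      have C_iff: "\<omega> \<in> C (g n j) \<longleftrightarrow> \<kappa> n \<le> j" if "j \<le> k" for j
        using \<tau>_iff[of "g n j"] g(1)[of n j] g(2)[of j n] k that \<kappa>_iff by auto
      then have "(\<exists>j<k. \<omega> \<in> C (g n j)) \<longleftrightarrow> (\<exists>j<k. \<kappa> n \<le> j)"
        by (meson less_imp_le)
      then have "\<omega> \<in> A n k \<longleftrightarrow> (\<kappa> n \<le> k \<and> \<not> (\<exists>j<k. \<kappa> n \<le> j)) \<and> \<bar>d (g n k) \<omega>\<bar> \<le> 1"
        unfolding A_def using C_iff[of k] by blast
      also have "(\<kappa> n \<le> k \<and> \<not> (\<exists>j<k. \<kappa> n \<le> j)) \<longleftrightarrow> k = \<kappa> n"
        by (metis le_neq_implies_less not_le order_refl)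
      finally show ?thesis by auto
    qed
    ultimately show ?thesis using \<kappa>_le \<tau> by auto
  qed
  have off: "\<omega> \<notin> A n k" if "\<omega> \<notin> C t" "k \<le> Suc n" for \<omega> n k
    using mono[of "g n k"] g that by (auto simp: A_def)
  have Z_val: "\<exists>\<kappa>. (\<lambda>n. d (g n (\<kappa> n)) \<omega>) \<longlonglongrightarrow> 0 \<and>
      (\<forall>n. Z n \<omega> = (if \<bar>d (g n (\<kappa> n)) \<omega>\<bar> \<le> 1 then d (g n (\<kappa> n)) \<omega> else 0) \<and>
           V n \<omega> = (if \<bar>d (g n (\<kappa> n)) \<omega>\<bar> \<le> 1 then d t \<omega> else 0))" if \<omega>: "\<omega> \<in> C t" for \<omega>
  proof -
    obtain \<kappa> where \<kappa>: "\<And>n. \<kappa> n \<le> Suc n" "(\<lambda>n. d (g n (\<kappa> n)) \<omega>) \<longlonglongrightarrow> 0"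
      "\<And>n k. k \<le> Suc n \<Longrightarrow> (\<omega> \<in> A n k \<longleftrightarrow> k = \<kappa> n \<and> \<bar>d (g n (\<kappa> n)) \<omega>\<bar> \<le> 1)"
      using ptw[OF \<omega>] by blast
    have *: "(\<Sum>k\<le>Suc n. indicator (A n k) \<omega> * f k) =
        (if \<bar>d (g n (\<kappa> n)) \<omega>\<bar> \<le> 1 then f (\<kappa> n) else (0::real))" for n and f :: "nat \<Rightarrow> real"
    proof -
      have "(\<Sum>k\<le>Suc n. indicator (A n k) \<omega> * f k) =
        (\<Sum>k\<le>Suc n. if k = \<kappa> n then (if \<bar>d (g n (\<kappa> n)) \<omega>\<bar> \<le> 1 then f (\<kappa> n) else 0) else 0)"
        by (rule sum.cong) (auto simp: indicator_def \<kappa>(3))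
      also have "\<dots> = (if \<bar>d (g n (\<kappa> n)) \<omega>\<bar> \<le> 1 then f (\<kappa> n) else 0)"
        using \<kappa>(1)[of n] by (subst sum.delta) auto
      finally show ?thesis .
    qed
    show ?thesis
      unfolding Z_def V_def * using \<kappa>(2) by blast
  qed
  have Z_off: "Z n \<omega> = 0" "V n \<omega> = 0" if "\<omega> \<notin> C t" for n \<omega>
    using off[OF that] by (auto simp: Z_def V_def simp del: sum.atMost_Suc intro!: sum.neutral)
  have "(\<lambda>n. \<integral>\<omega>. Z n \<omega> \<partial>M) \<longlonglongrightarrow> (\<integral>\<omega>. 0 \<partial>M)"
  proof (rule integral_dominated_convergence[where w = "\<lambda>_. 1"])
    have "(\<lambda>n. Z n \<omega>) \<longlonglongrightarrow> 0" for \<omega>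
    proof (cases "\<omega> \<in> C t")
      case True
      obtain \<kappa> where \<kappa>: "(\<lambda>n. d (g n (\<kappa> n)) \<omega>) \<longlonglongrightarrow> 0"
        "\<And>n. Z n \<omega> = (if \<bar>d (g n (\<kappa> n)) \<omega>\<bar> \<le> 1 then d (g n (\<kappa> n)) \<omega> else 0)"
        using Z_val[OF True] by blast
      show ?thesis
        by (rule tendsto_rabs_zero_cancel, rule real_tendsto_sandwich[OF _ _ tendsto_const tendsto_rabs_zero[OF \<kappa>(1)]])
           (auto simp: \<kappa>(2))
    qed (simp add: Z_off)
    then show "AE \<omega> in M. (\<lambda>n. Z n \<omega>) \<longlonglongrightarrow> 0" by simp
    have "norm (Z n \<omega>) \<le> 1" for n \<omega>
      using Z_val[of \<omega>] Z_off[of \<omega> n] by (cases "\<omega> \<in> C t") auto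
    then show "AE \<omega> in M. norm (Z n \<omega>) \<le> 1" for n by simp
  qed (use Z_meas in auto)
  \<comment> \<open>Here \<open>\<bar>d t\<bar>\<close> dominates. Since \<open>d\<close> at the
    rounded time tends to 0, the cutoff is eventually inactive, and nothing is lost on
    \<open>C t\<close>.\<close>
  moreover have "(\<lambda>n. \<integral>\<omega>. V n \<omega> \<partial>M) \<longlonglongrightarrow> (\<integral>\<omega>. indicator (C t) \<omega> * d t \<omega> \<partial>M)"
  proof (rule integral_dominated_convergence[where w = "\<lambda>\<omega>. \<bar>d t \<omega>\<bar>"])
    have "(\<lambda>n. V n \<omega>) \<longlonglongrightarrow> indicator (C t) \<omega> * d t \<omega>" for \<omega>
    proof (cases "\<omega> \<in> C t")
      case True
      obtain \<kappa> where \<kappa>: "(\<lambda>n. d (g n (\<kappa> n)) \<omega>) \<longlonglongrightarrow> 0"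
        "\<And>n. V n \<omega> = (if \<bar>d (g n (\<kappa> n)) \<omega>\<bar> \<le> 1 then d t \<omega> else 0)"
        using Z_val[OF True] by blast
      have "\<forall>\<^sub>F n in sequentially. \<bar>d (g n (\<kappa> n)) \<omega>\<bar> < 1"
        using order_tendstoD(2)[OF tendsto_rabs_zero[OF \<kappa>(1)], of 1] by simp
      then have "\<forall>\<^sub>F n in sequentially. V n \<omega> = indicator (C t) \<omega> * d t \<omega>"
        by eventually_elim (use True in \<open>auto simp: \<kappa>(2)\<close>)
      then show ?thesis by (rule tendsto_eventually)
    qed (simp add: Z_off)
    then show "AE \<omega> in M. (\<lambda>n. V n \<omega>) \<longlonglongrightarrow> indicator (C t) \<omega> * d t \<omega>" by simp
    have "norm (V n \<omega>) \<le> \<bar>d t \<omega>\<bar>" for n \<omega>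
      using Z_val[of \<omega>] Z_off[of \<omega> n] by (cases "\<omega> \<in> C t") auto
    then show "AE \<omega> in M. norm (V n \<omega>) \<le> \<bar>d t \<omega>\<bar>" for n by simp
    show "(\<lambda>\<omega>. indicator (C t) \<omega> * d t \<omega>) \<in> borel_measurable M"
      using integrable[of t] t by auto
  qed (use V_meas integrable[of t] t in auto)
  ultimately show ?thesis
    unfolding ZV by (auto dest: LIMSEQ_unique)
qed

section \<open>Changing the eigenfunction of a single diffusion\<close>

text \<open>Densities are known to be continuous only on the interval, whereas integration over the
  line needs measurability everywhere; extension by zero off the open square provides it.\<close>

lemma borel_measurable_ennreal_indicator_Times:
  fixes q :: "real \<Rightarrow> real \<Rightarrow> real"
  assumes "open S" and "continuous_on (S \<times> S) (\<lambda>(y, z). q y z)"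
  shows "(\<lambda>(y, z). indicator (S \<times> S) (y, z) * ennreal (q y z)) \<in> borel_measurable (borel \<Otimes>\<^sub>M borel)"
proof -
  have "(\<lambda>w. indicator (S \<times> S) w *\<^sub>R (case w of (y, z) \<Rightarrow> q y z)) \<in> borel_measurable borel"
    using assms by (intro borel_measurable_continuous_on_indicator borel_open open_Times)
  then have "(\<lambda>w. ennreal (indicator (S \<times> S) w *\<^sub>R (case w of (y, z) \<Rightarrow> q y z))) \<in>
      borel_measurable (borel \<Otimes>\<^sub>M borel)"
    by (simp add: borel_prod)
  also have "(\<lambda>w. ennreal (indicator (S \<times> S) w *\<^sub>R (case w of (y, z) \<Rightarrow> q y z))) =
      (\<lambda>(y, z). indicator (S \<times> S) (y, z) * ennreal (q y z))"
    by (auto simp: indicator_def fun_eq_iff)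
  finally show ?thesis .
qed

lemma markov_process_measurable_path:
  assumes "markov_process l r q M X x"
  shows "(\<lambda>\<omega>. \<lambda>u\<in>{0..s}. X u \<omega>) \<in> measurable M (\<Pi>\<^sub>M u\<in>{0..s}. borel)"
  using assms by (intro measurable_restrict) (auto simp: markov_process_def)

text \<open>The definition of \<open>markov_process\<close> covers only events
  \<open>X (s + u) \<omega> \<in> B\<close>. Both sides are integrals of \<open>f\<close> against
  measures on the line, and measures that agree on all Borel sets integrate every nonnegative
  \<open>f\<close> equally.\<close>

lemma markov_process_nn_integral:
  fixes f :: "real \<Rightarrow> ennreal"
  assumes mp: "markov_process l r q M X x"
    and cont: "continuous_on (einterval l r \<times> einterval l r) (\<lambda>(y, z). q u y z)"
    and s: "0 \<le> s" and u: "0 < u"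
    and A: "A \<in> sets (\<Pi>\<^sub>M u\<in>{0..s}. (borel :: real measure))"
    and f[measurable]: "f \<in> borel_measurable borel"
  shows "(\<integral>\<^sup>+\<omega>. indicator A (\<lambda>u\<in>{0..s}. X u \<omega>) * f (X (s + u) \<omega>) \<partial>M) =
     (\<integral>\<^sup>+\<omega>. indicator A (\<lambda>u\<in>{0..s}. X u \<omega>) *
        (\<integral>\<^sup>+y\<in>einterval l r. ennreal (q u (X s \<omega>) y) * f y \<partial>lborel) \<partial>M)"
proof -
  interpret prob_space M using mp by (simp add: markov_process_def)
  interpret pair_sigma_finite M lborel ..
  let ?E = "einterval l r"
  note A[measurable] markov_process_measurable_path[OF mp, measurable]
  have X[measurable]: "\<And>v. 0 \<le> v \<Longrightarrow> X v \<in> borel_measurable M"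
    and XE: "\<And>v \<omega>. 0 \<le> v \<Longrightarrow> \<omega> \<in> space M \<Longrightarrow> X v \<omega> \<in> ?E"
    using mp by (auto simp: markov_process_def)
  have [measurable]: "X s \<in> borel_measurable M" "X (s + u) \<in> borel_measurable M"
    using X s u by auto
  define I where "I \<omega> = (indicator A (\<lambda>u\<in>{0..s}. X u \<omega>) :: ennreal)" for \<omega>
  have I[measurable]: "I \<in> borel_measurable M"
    unfolding I_def by measurable
  define G where "G = (\<lambda>(y, z). indicator (?E \<times> ?E) (y, z) * ennreal (q u y z))"
  have G[measurable]: "G \<in> borel_measurable (borel \<Otimes>\<^sub>M borel)"
    unfolding G_def by (rule borel_measurable_ennreal_indicator_Times) (use cont in auto)
  \<comment> \<open>\<open>\<nu>\<close> is the law of \<open>X (s + u)\<close> restricted to the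
    past event; \<open>\<nu>'\<close> is the one predicted by the transition density, written with a
    Lebesgue density so that Fubini (\<open>swap\<close>) applies.\<close>
  define \<nu> where "\<nu> = distr (density M I) borel (X (s + u))"
  define \<nu>' where "\<nu>' = density lborel (\<lambda>y. \<integral>\<^sup>+\<omega>. I \<omega> * G (X s \<omega>, y) \<partial>M)"
  have swap: "(\<integral>\<^sup>+y. h y * (\<integral>\<^sup>+\<omega>. I \<omega> * G (X s \<omega>, y) \<partial>M) \<partial>lborel) =
      (\<integral>\<^sup>+\<omega>. I \<omega> * (\<integral>\<^sup>+y\<in>?E. ennreal (q u (X s \<omega>) y) * h y \<partial>lborel) \<partial>M)"
    if [measurable]: "h \<in> borel_measurable borel" for h
  proof -
    have "(\<integral>\<^sup>+y. h y * (\<integral>\<^sup>+\<omega>. I \<omega> * G (X s \<omega>, y) \<partial>M) \<partial>lborel) =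
        (\<integral>\<^sup>+y. (\<integral>\<^sup>+\<omega>. h y * (I \<omega> * G (X s \<omega>, y)) \<partial>M) \<partial>lborel)"
      by (subst nn_integral_cmult) auto
    also have "\<dots> = (\<integral>\<^sup>+\<omega>. (\<integral>\<^sup>+y. h y * (I \<omega> * G (X s \<omega>, y)) \<partial>lborel) \<partial>M)"
      by (rule Fubini') measurable
    also have "\<dots> = (\<integral>\<^sup>+\<omega>. I \<omega> * (\<integral>\<^sup>+y\<in>?E. ennreal (q u (X s \<omega>) y) * h y \<partial>lborel) \<partial>M)"
    proof (rule nn_integral_cong)
      fix \<omega> assume \<omega>: "\<omega> \<in> space M"
      have "(\<integral>\<^sup>+y. h y * (I \<omega> * G (X s \<omega>, y)) \<partial>lborel) =
          (\<integral>\<^sup>+y. I \<omega> * (h y * G (X s \<omega>, y)) \<partial>lborel)"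
        by (simp add: ac_simps)
      also have "\<dots> = I \<omega> * (\<integral>\<^sup>+y. h y * G (X s \<omega>, y) \<partial>lborel)"
        by (rule nn_integral_cmult) simp
      also have "(\<integral>\<^sup>+y. h y * G (X s \<omega>, y) \<partial>lborel) =
          (\<integral>\<^sup>+y\<in>?E. ennreal (q u (X s \<omega>) y) * h y \<partial>lborel)"
        by (rule nn_integral_cong) (use XE[OF s \<omega>] in \<open>auto simp: G_def indicator_def ac_simps\<close>)
      finally show "(\<integral>\<^sup>+y. h y * (I \<omega> * G (X s \<omega>, y)) \<partial>lborel) =
          I \<omega> * (\<integral>\<^sup>+y\<in>?E. ennreal (q u (X s \<omega>) y) * h y \<partial>lborel)" .
    qed
    finally show ?thesis .
  qed
  have "\<nu> = \<nu>'"
  proof (rule measure_eqI)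
    fix B assume "B \<in> sets \<nu>"
    then have B[measurable]: "B \<in> sets borel" by (simp add: \<nu>_def)
    let ?P = "{\<omega>\<in>space M. (\<lambda>u\<in>{0..s}. X u \<omega>) \<in> A}"
    have P: "?P \<in> sets M" by measurable
    have "emeasure \<nu> B = (\<integral>\<^sup>+\<omega>. I \<omega> * indicator B (X (s + u) \<omega>) \<partial>M)"
      unfolding \<nu>_def using measurable_sets[of "X (s + u)" M borel B]
      by (auto simp: emeasure_distr emeasure_density indicator_def intro!: nn_integral_cong)
    also have "\<dots> = (\<integral>\<^sup>+\<omega>. indicator {\<omega>\<in>space M. (\<lambda>u\<in>{0..s}. X u \<omega>) \<in> A \<and> X (s + u) \<omega> \<in> B} \<omega> \<partial>M)"
      by (rule nn_integral_cong) (auto simp: I_def indicator_def)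
    also have "\<dots> = emeasure M {\<omega>\<in>space M. (\<lambda>u\<in>{0..s}. X u \<omega>) \<in> A \<and> X (s + u) \<omega> \<in> B}"
      by (rule nn_integral_indicator) measurable
    also have "\<dots> = (\<integral>\<^sup>+\<omega>\<in>?P. (\<integral>\<^sup>+y\<in>B \<inter> ?E. ennreal (q u (X s \<omega>) y) \<partial>lborel) \<partial>M)"
      using mp s u A B unfolding markov_process_def by blast
    also have "\<dots> = (\<integral>\<^sup>+\<omega>. I \<omega> * (\<integral>\<^sup>+y\<in>?E. ennreal (q u (X s \<omega>) y) * indicator B y \<partial>lborel) \<partial>M)"
      by (rule nn_integral_cong)
         (auto simp: I_def indicator_inter_arith indicator_def intro!: nn_integral_cong)
    also have "\<dots> = (\<integral>\<^sup>+y. indicator B y * (\<integral>\<^sup>+\<omega>. I \<omega> * G (X s \<omega>, y) \<partial>M) \<partial>lborel)"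
      by (rule swap[symmetric]) measurable
    also have "\<dots> = emeasure \<nu>' B"
      unfolding \<nu>'_def by (subst emeasure_density) (auto simp: mult.commute)
    finally show "emeasure \<nu> B = emeasure \<nu>' B" .
  qed (simp add: \<nu>_def \<nu>'_def)
  have "(\<integral>\<^sup>+\<omega>. I \<omega> * f (X (s + u) \<omega>) \<partial>M) = (\<integral>\<^sup>+y. f y \<partial>\<nu>)"
    unfolding \<nu>_def by (subst nn_integral_distr) (auto simp: nn_integral_density)
  also have "\<dots> = (\<integral>\<^sup>+y. f y * (\<integral>\<^sup>+\<omega>. I \<omega> * G (X s \<omega>, y) \<partial>M) \<partial>lborel)"
    unfolding \<open>\<nu> = \<nu>'\<close> \<nu>'_def by (subst nn_integral_density) (auto simp: mult.commute)
  also have "\<dots> = (\<integral>\<^sup>+\<omega>. I \<omega> * (\<integral>\<^sup>+y\<in>?E. ennreal (q u (X s \<omega>) y) * f y \<partial>lborel) \<partial>M)"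
    by (rule swap) measurable
  finally show ?thesis unfolding I_def .
qed

text \<open>Both densities are reweightings of the same \<open>p\<close>: the factor
  \<open>\<psi> \<mu> z / \<psi> \<kappa> z\<close> exchanges the eigenfunction in the variable
  \<open>z\<close>, and what is left over depends on \<open>u\<close> and \<open>y\<close>
  alone.\<close>

lemma doob_density_change:
  assumes p: "\<And>z. z \<in> S \<Longrightarrow> 0 \<le> p u y z" and \<psi>: "\<And>\<nu> z. \<nu> \<in> {\<mu>, \<kappa>} \<Longrightarrow> z \<in> S \<Longrightarrow> 0 < \<psi> \<nu> z"
    and y: "y \<in> S" and [measurable]: "S \<in> sets borel" "(\<lambda>z. indicator S z * ennreal (doob_density p \<mu> (\<psi> \<mu>) u y z)) \<in> borel_measurable borel"
    "h \<in> borel_measurable borel"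
  shows "(\<integral>\<^sup>+z\<in>S. ennreal (doob_density p \<kappa> (\<psi> \<kappa>) u y z) * (ennreal (\<psi> \<mu> z / \<psi> \<kappa> z) * h z) \<partial>lborel) =
     ennreal (exp ((\<mu> - \<kappa>) * u) * (\<psi> \<mu> y / \<psi> \<kappa> y)) *
     (\<integral>\<^sup>+z\<in>S. ennreal (doob_density p \<mu> (\<psi> \<mu>) u y z) * h z \<partial>lborel)"
proof -
  have "(\<integral>\<^sup>+z\<in>S. ennreal (doob_density p \<kappa> (\<psi> \<kappa>) u y z) * (ennreal (\<psi> \<mu> z / \<psi> \<kappa> z) * h z) \<partial>lborel) =
    (\<integral>\<^sup>+z. ennreal (exp ((\<mu> - \<kappa>) * u) * (\<psi> \<mu> y / \<psi> \<kappa> y)) *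
       ((indicator S z * ennreal (doob_density p \<mu> (\<psi> \<mu>) u y z)) * h z) \<partial>lborel)"
  proof (rule nn_integral_cong)
    fix z
    show "ennreal (doob_density p \<kappa> (\<psi> \<kappa>) u y z) * (ennreal (\<psi> \<mu> z / \<psi> \<kappa> z) * h z) * indicator S z =
       ennreal (exp ((\<mu> - \<kappa>) * u) * (\<psi> \<mu> y / \<psi> \<kappa> y)) *
       ((indicator S z * ennreal (doob_density p \<mu> (\<psi> \<mu>) u y z)) * h z)"
    proof (cases "z \<in> S")
      case True
      have pos: "0 < \<psi> \<mu> y" "0 < \<psi> \<kappa> y" "0 < \<psi> \<mu> z" "0 < \<psi> \<kappa> z"
        using \<psi> True y by auto
      have "doob_density p \<kappa> (\<psi> \<kappa>) u y z * (\<psi> \<mu> z / \<psi> \<kappa> z) =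
        exp ((\<mu> - \<kappa>) * u) * (\<psi> \<mu> y / \<psi> \<kappa> y) * doob_density p \<mu> (\<psi> \<mu>) u y z"
        using pos by (simp add: doob_density_def field_simps exp_diff exp_minus)
      moreover have "0 \<le> doob_density p \<kappa> (\<psi> \<kappa>) u y z" "0 \<le> doob_density p \<mu> (\<psi> \<mu>) u y z"
        using p[OF True] pos by (auto simp: doob_density_def)
      ultimately have "ennreal (doob_density p \<kappa> (\<psi> \<kappa>) u y z) * ennreal (\<psi> \<mu> z / \<psi> \<kappa> z) =
        ennreal (exp ((\<mu> - \<kappa>) * u) * (\<psi> \<mu> y / \<psi> \<kappa> y)) * ennreal (doob_density p \<mu> (\<psi> \<mu>) u y z)"
        using pos by (simp flip: ennreal_mult')
      with True show ?thesis by (simp add: mult.assoc[symmetric])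
    qed simp
  qed
  also have "\<dots> = ennreal (exp ((\<mu> - \<kappa>) * u) * (\<psi> \<mu> y / \<psi> \<kappa> y)) *
     (\<integral>\<^sup>+z. (indicator S z * ennreal (doob_density p \<mu> (\<psi> \<mu>) u y z)) * h z \<partial>lborel)"
    by (rule nn_integral_cmult) measurable
  finally show ?thesis by (simp add: ac_simps)
qed

text \<open>The Markov property at time 0, where the past event is the whole path space and the
  position is the deterministic \<open>x\<close>.\<close>

lemma markov_process_nn_integral_initial:
  fixes f :: "real \<Rightarrow> ennreal"
  assumes mp: "markov_process l r q M X x"
    and cont: "continuous_on (einterval l r \<times> einterval l r) (\<lambda>(y, z). q t y z)"
    and t: "0 < t" and f: "f \<in> borel_measurable borel"
  shows "(\<integral>\<^sup>+\<omega>. f (X t \<omega>) \<partial>M) = (\<integral>\<^sup>+y\<in>einterval l r. ennreal (q t x y) * f y \<partial>lborel)"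
proof -
  interpret prob_space M using mp by (simp add: markov_process_def)
  let ?U = "space (\<Pi>\<^sub>M u\<in>{0..0}. (borel :: real measure))"
  have U: "(\<lambda>u\<in>{0..0}. X u \<omega>) \<in> ?U" for \<omega>
    by (simp add: space_PiM)
  have "(\<integral>\<^sup>+\<omega>. f (X t \<omega>) \<partial>M) = (\<integral>\<^sup>+\<omega>. indicator ?U (\<lambda>u\<in>{0..0}. X u \<omega>) * f (X (0 + t) \<omega>) \<partial>M)"
    using U by (simp add: indicator_def)
  also have "\<dots> = (\<integral>\<^sup>+\<omega>. indicator ?U (\<lambda>u\<in>{0..0}. X u \<omega>) *
      (\<integral>\<^sup>+y\<in>einterval l r. ennreal (q t (X 0 \<omega>) y) * f y \<partial>lborel) \<partial>M)"
    by (rule markov_process_nn_integral[OF mp cont _ t _ f]) auto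
  also have "\<dots> = (\<integral>\<^sup>+\<omega>. (\<integral>\<^sup>+y\<in>einterval l r. ennreal (q t x y) * f y \<partial>lborel) \<partial>M)"
    using mp U by (intro nn_integral_cong) (auto simp: markov_process_def indicator_def)
  finally show ?thesis by (simp add: emeasure_space_1)
qed

section \<open>Ratios of eigenfunctions along a single Doob transform\<close>

text \<open>The existence of path laws serves twice: through it the transformed densities are
  transition densities, in particular of mass 1, and it provides the laws to which (AO) is
  applied.\<close>

locale doob_transforms =
  fixes l r :: ereal and a b :: "real \<Rightarrow> real" and p :: "real \<Rightarrow> real \<Rightarrow> real \<Rightarrow> real"
    and \<psi> :: "real \<Rightarrow> real \<Rightarrow> real"
  assumes p: "transition_density l r a b p"
    and psi_0: "\<forall>y\<in>einterval l r. \<psi> 0 y = 1"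
    and psi_eigen: "\<forall>\<mu>>0. increasing_eigenfunction l r a b \<mu> (\<psi> \<mu>)"
    and diffusions_exist: "\<forall>\<mu>\<ge>0. \<forall>y\<in>einterval l r. \<exists>P. doob_path_law l r a b p \<psi> \<mu> y P"
begin

lemma psi_pos: "0 \<le> \<mu> \<Longrightarrow> z \<in> einterval l r \<Longrightarrow> 0 < \<psi> \<mu> z"
  using psi_0 psi_eigen by (cases "\<mu> = 0") (auto simp: increasing_eigenfunction_def)

lemma psi_cont: assumes "0 \<le> \<mu>" shows "continuous_on (einterval l r) (\<psi> \<mu>)"
proof (cases "\<mu> = 0")
  case True
  then have "continuous_on (einterval l r) (\<psi> \<mu>) \<longleftrightarrow> continuous_on (einterval l r) (\<lambda>_. 1 :: real)"
    using psi_0 by (intro continuous_on_cong) auto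
  then show ?thesis by simp
next
  case False
  with assms psi_eigen show ?thesis
    by (intro continuous_at_imp_continuous_on)
       (auto simp: increasing_eigenfunction_def intro: field_differentiable_imp_continuous_at)
qed

lemma psi_ratio_measurable:
  assumes "0 \<le> \<mu>" "0 \<le> \<kappa>"
  shows "(\<lambda>z. indicator (einterval l r) z * ennreal (\<psi> \<mu> z / \<psi> \<kappa> z)) \<in> borel_measurable borel"
proof -
  have "continuous_on (einterval l r) (\<lambda>z. \<psi> \<mu> z / \<psi> \<kappa> z)"
    using psi_pos[OF assms(2)] by (intro continuous_on_divide psi_cont assms) force
  then have "(\<lambda>z. indicator (einterval l r) z *\<^sub>R (\<psi> \<mu> z / \<psi> \<kappa> z)) \<in> borel_measurable borel"
    by (intro borel_measurable_continuous_on_indicator) auto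
  then have "(\<lambda>z. ennreal (indicator (einterval l r) z *\<^sub>R (\<psi> \<mu> z / \<psi> \<kappa> z))) \<in> borel_measurable borel"
    by simp
  also have "(\<lambda>z. ennreal (indicator (einterval l r) z *\<^sub>R (\<psi> \<mu> z / \<psi> \<kappa> z))) =
      (\<lambda>z. indicator (einterval l r) z * ennreal (\<psi> \<mu> z / \<psi> \<kappa> z))"
    by (auto simp: indicator_def)
  finally show ?thesis .
qed

text \<open>A path law carries its transition density by definition, so one law from one starting
  point suffices; \<open>y\<close> only supplies such a point.\<close>

lemma doob_transition_density:
  assumes "0 \<le> \<mu>" "y \<in> einterval l r"
  shows "transition_density l r a (doob_drift a b (\<psi> \<mu>)) (doob_density p \<mu> (\<psi> \<mu>))"
  using diffusions_exist assms
  unfolding doob_path_law_def doob_diffusion_def diffusion_def by blast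

lemma doob_density_cont:
  assumes "0 \<le> \<mu>" "0 < u"
  shows "continuous_on (einterval l r \<times> einterval l r) (\<lambda>(y, z). doob_density p \<mu> (\<psi> \<mu>) u y z)"
proof (cases "einterval l r = {}")
  case False
  then obtain y where "y \<in> einterval l r" by blast
  from doob_transition_density[OF assms(1) this]
  have c: "continuous_on ({0<..} \<times> einterval l r \<times> einterval l r)
      (\<lambda>(t, x, y). doob_density p \<mu> (\<psi> \<mu>) t x y)"
    by (simp add: transition_density_def)
  have "continuous_on (einterval l r \<times> einterval l r)
     (\<lambda>w. case (u, w) of (t, x, y) \<Rightarrow> doob_density p \<mu> (\<psi> \<mu>) t x y)"
    by (rule continuous_on_compose2[OF c]) (use assms in \<open>auto intro!: continuous_intros\<close>)
  then show ?thesis by (simp add: case_prod_unfold)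
qed simp

text \<open>Conservativity of each transform: this makes the ratios true martingales instead of mere
  supermartingales.\<close>

lemma doob_density_mass:
  assumes "0 \<le> \<mu>" "0 < u" "y \<in> einterval l r"
  shows "(\<integral>\<^sup>+z\<in>einterval l r. ennreal (doob_density p \<mu> (\<psi> \<mu>) u y z) \<partial>lborel) = 1"
  using doob_transition_density[OF assms(1,3)] assms by (auto simp: transition_density_def)

lemma doob_change_of_measure:
  assumes "0 \<le> \<mu>" "0 \<le> \<kappa>" "0 < u" "y \<in> einterval l r" and h: "h \<in> borel_measurable borel"
  shows "(\<integral>\<^sup>+z\<in>einterval l r. ennreal (doob_density p \<kappa> (\<psi> \<kappa>) u y z) *
           (ennreal (\<psi> \<mu> z / \<psi> \<kappa> z) * h z) \<partial>lborel) =
     ennreal (exp ((\<mu> - \<kappa>) * u) * (\<psi> \<mu> y / \<psi> \<kappa> y)) *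
     (\<integral>\<^sup>+z\<in>einterval l r. ennreal (doob_density p \<mu> (\<psi> \<mu>) u y z) * h z \<partial>lborel)"
proof (rule doob_density_change)
  show "0 \<le> p u y z" if "z \<in> einterval l r" for z
    using p assms that by (auto simp: transition_density_def)
  show "0 < \<psi> \<nu> z" if "\<nu> \<in> {\<mu>, \<kappa>}" "z \<in> einterval l r" for \<nu> z
    using psi_pos assms that by auto
  have "continuous_on (einterval l r) (\<lambda>z. case (y, z) of (y, z) \<Rightarrow> doob_density p \<mu> (\<psi> \<mu>) u y z)"
    by (rule continuous_on_compose2[OF doob_density_cont])
       (use assms in \<open>auto intro!: continuous_intros\<close>)
  then have "continuous_on (einterval l r) (doob_density p \<mu> (\<psi> \<mu>) u y)" by simp
  then have "(\<lambda>z. indicator (einterval l r) z *\<^sub>R doob_density p \<mu> (\<psi> \<mu>) u y z) \<in> borel_measurable borel"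
    by (intro borel_measurable_continuous_on_indicator) auto
  then have "(\<lambda>z. ennreal (indicator (einterval l r) z *\<^sub>R doob_density p \<mu> (\<psi> \<mu>) u y z)) \<in> borel_measurable borel"
    by simp
  also have "(\<lambda>z. ennreal (indicator (einterval l r) z *\<^sub>R doob_density p \<mu> (\<psi> \<mu>) u y z)) =
      (\<lambda>z. indicator (einterval l r) z * ennreal (doob_density p \<mu> (\<psi> \<mu>) u y z))"
    by (auto simp: indicator_def)
  finally show "\<dots> \<in> borel_measurable borel" .
qed (use assms in auto)

text \<open>Integrating \<open>\<psi> \<mu> / \<psi> \<kappa>\<close> against the
  \<open>\<kappa>\<close>-density produces the ratio at the current point times the mass of the
  \<open>\<mu>\<close>-density, which is 1. The exponential factor remains here and disappears only
  in a product over a permutation.\<close>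

lemma doob_diffusion_ratio_martingale:
  assumes X: "doob_diffusion l r a b p \<psi> \<kappa> M X x"
    and nn: "0 \<le> \<mu>" "0 \<le> \<kappa>" "0 \<le> s" "0 \<le> u"
    and A: "A \<in> sets (\<Pi>\<^sub>M v\<in>{0..s}. (borel :: real measure))"
  shows "(\<integral>\<^sup>+\<omega>. indicator A (\<lambda>v\<in>{0..s}. X v \<omega>) *
            ennreal (\<psi> \<mu> (X (s + u) \<omega>) / \<psi> \<kappa> (X (s + u) \<omega>)) \<partial>M) =
     ennreal (exp ((\<mu> - \<kappa>) * u)) *
     (\<integral>\<^sup>+\<omega>. indicator A (\<lambda>v\<in>{0..s}. X v \<omega>) * ennreal (\<psi> \<mu> (X s \<omega>) / \<psi> \<kappa> (X s \<omega>)) \<partial>M)"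
proof (cases "u = 0")
  case False
  then have u: "0 < u" using nn by simp
  have mp: "markov_process l r (doob_density p \<kappa> (\<psi> \<kappa>)) M X x"
    using X by (simp add: doob_diffusion_def diffusion_def)
  then interpret prob_space M by (simp add: markov_process_def)
  let ?E = "einterval l r"
  let ?I = "\<lambda>\<omega>. indicator A (\<lambda>v\<in>{0..s}. X v \<omega>) :: ennreal"
  note A[measurable] markov_process_measurable_path[OF mp, measurable]
  define \<rho> where "\<rho> z = indicator ?E z * ennreal (\<psi> \<mu> z / \<psi> \<kappa> z)" for z
  have \<rho>[measurable]: "\<rho> \<in> borel_measurable borel"
    unfolding \<rho>_def using psi_ratio_measurable nn by auto
  have Xm[measurable]: "X s \<in> borel_measurable M"
    using mp nn by (auto simp: markov_process_def)
  have XE: "X v \<omega> \<in> ?E" if "0 \<le> v" "\<omega> \<in> space M" for v \<omega>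
    using mp that by (auto simp: markov_process_def)
  have \<rho>X: "ennreal (\<psi> \<mu> (X v \<omega>) / \<psi> \<kappa> (X v \<omega>)) = \<rho> (X v \<omega>)" if "0 \<le> v" "\<omega> \<in> space M" for v \<omega>
    using XE[OF that] by (simp add: \<rho>_def)
  have step: "(\<integral>\<^sup>+z\<in>?E. ennreal (doob_density p \<kappa> (\<psi> \<kappa>) u y z) * \<rho> z \<partial>lborel) =
      ennreal (exp ((\<mu> - \<kappa>) * u)) * \<rho> y" if y: "y \<in> ?E" for y
  proof -
    have "(\<integral>\<^sup>+z\<in>?E. ennreal (doob_density p \<kappa> (\<psi> \<kappa>) u y z) * \<rho> z \<partial>lborel) =
      (\<integral>\<^sup>+z\<in>?E. ennreal (doob_density p \<kappa> (\<psi> \<kappa>) u y z) * (ennreal (\<psi> \<mu> z / \<psi> \<kappa> z) * 1) \<partial>lborel)"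
      by (rule nn_integral_cong) (auto simp: \<rho>_def indicator_def)
    also have "\<dots> = ennreal (exp ((\<mu> - \<kappa>) * u) * (\<psi> \<mu> y / \<psi> \<kappa> y))"
      using doob_density_mass[OF nn(1) u y]
      by (subst doob_change_of_measure) (use nn u y in auto)
    also have "\<dots> = ennreal (exp ((\<mu> - \<kappa>) * u)) * \<rho> y"
      using psi_pos[OF nn(1) y] psi_pos[OF nn(2) y] y by (simp add: \<rho>_def flip: ennreal_mult')
    finally show ?thesis .
  qed
  have "(\<integral>\<^sup>+\<omega>. ?I \<omega> * ennreal (\<psi> \<mu> (X (s + u) \<omega>) / \<psi> \<kappa> (X (s + u) \<omega>)) \<partial>M) =
      (\<integral>\<^sup>+\<omega>. ?I \<omega> * \<rho> (X (s + u) \<omega>) \<partial>M)"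
    using nn by (intro nn_integral_cong) (simp add: \<rho>X)
  also have "\<dots> = (\<integral>\<^sup>+\<omega>. ?I \<omega> *
      (\<integral>\<^sup>+z\<in>?E. ennreal (doob_density p \<kappa> (\<psi> \<kappa>) u (X s \<omega>) z) * \<rho> z \<partial>lborel) \<partial>M)"
    by (rule markov_process_nn_integral[OF mp doob_density_cont]) (use nn u in auto)
  also have "\<dots> = (\<integral>\<^sup>+\<omega>. ennreal (exp ((\<mu> - \<kappa>) * u)) * (?I \<omega> * \<rho> (X s \<omega>)) \<partial>M)"
    using nn by (intro nn_integral_cong) (simp only: step XE mult.left_commute)
  also have "\<dots> = ennreal (exp ((\<mu> - \<kappa>) * u)) * (\<integral>\<^sup>+\<omega>. ?I \<omega> * \<rho> (X s \<omega>) \<partial>M)"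
    by (rule nn_integral_cmult) measurable
  also have "(\<integral>\<^sup>+\<omega>. ?I \<omega> * \<rho> (X s \<omega>) \<partial>M) =
      (\<integral>\<^sup>+\<omega>. ?I \<omega> * ennreal (\<psi> \<mu> (X s \<omega>) / \<psi> \<kappa> (X s \<omega>)) \<partial>M)"
    using nn by (intro nn_integral_cong) (simp add: \<rho>X)
  finally show ?thesis .
qed simp

text \<open>The change of parameter at one fixed time: weighting by the ratio turns the
  \<open>\<kappa>\<close>-marginal into a multiple of the \<open>\<mu>\<close>-marginal. Nothing is
  claimed about whole paths, as (AO) compares positions at a single time.\<close>

lemma doob_diffusion_ratio_law:
  assumes X: "doob_diffusion l r a b p \<psi> \<kappa> M X x"
    and P: "doob_path_law l r a b p \<psi> \<mu> x P"
    and nn: "0 \<le> \<mu>" "0 \<le> \<kappa>" "0 < t"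
    and B: "B \<in> sets borel"
  shows "(\<integral>\<^sup>+\<omega>. ennreal (\<psi> \<mu> (X t \<omega>) / \<psi> \<kappa> (X t \<omega>)) * indicator B (X t \<omega>) \<partial>M) =
     ennreal (exp ((\<mu> - \<kappa>) * t) * (\<psi> \<mu> x / \<psi> \<kappa> x)) * emeasure (distr P borel (\<lambda>w. w t)) B"
proof -
  let ?E = "einterval l r"
  have mp: "markov_process l r (doob_density p \<kappa> (\<psi> \<kappa>)) M X x" and x: "x \<in> ?E"
    using X by (auto simp: doob_diffusion_def diffusion_def)
  have mpP: "markov_process l r (doob_density p \<mu> (\<psi> \<mu>)) P (\<lambda>t w. w t) x"
    using P by (simp add: doob_path_law_def doob_diffusion_def diffusion_def)
  have [measurable]: "(\<lambda>w. w t) \<in> borel_measurable P"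
    using mpP nn by (auto simp: markov_process_def)
  define \<rho> where "\<rho> z = indicator ?E z * ennreal (\<psi> \<mu> z / \<psi> \<kappa> z)" for z
  have \<rho>[measurable]: "\<rho> \<in> borel_measurable borel"
    unfolding \<rho>_def using psi_ratio_measurable nn by auto
  note B[measurable]
  have "emeasure (distr P borel (\<lambda>w. w t)) B = (\<integral>\<^sup>+z. indicator B z \<partial>distr P borel (\<lambda>w. w t))"
    by simp
  also have "\<dots> = (\<integral>\<^sup>+w. indicator B (w t) \<partial>P)"
    by (rule nn_integral_distr) auto
  also have "\<dots> = (\<integral>\<^sup>+z\<in>?E. ennreal (doob_density p \<mu> (\<psi> \<mu>) t x z) * indicator B z \<partial>lborel)"
    by (rule markov_process_nn_integral_initial[OF mpP doob_density_cont]) (use nn in auto)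
  finally have PB: "emeasure (distr P borel (\<lambda>w. w t)) B = \<dots>" .
  have "(\<integral>\<^sup>+\<omega>. ennreal (\<psi> \<mu> (X t \<omega>) / \<psi> \<kappa> (X t \<omega>)) * indicator B (X t \<omega>) \<partial>M) =
      (\<integral>\<^sup>+\<omega>. \<rho> (X t \<omega>) * indicator B (X t \<omega>) \<partial>M)"
    using mp nn by (intro nn_integral_cong) (auto simp: \<rho>_def markov_process_def)
  also have "\<dots> = (\<integral>\<^sup>+z\<in>?E. ennreal (doob_density p \<kappa> (\<psi> \<kappa>) t x z) * (\<rho> z * indicator B z) \<partial>lborel)"
    by (rule markov_process_nn_integral_initial[OF mp doob_density_cont]) (use nn in auto)
  also have "\<dots> = (\<integral>\<^sup>+z\<in>?E. ennreal (doob_density p \<kappa> (\<psi> \<kappa>) t x z) *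
      (ennreal (\<psi> \<mu> z / \<psi> \<kappa> z) * indicator B z) \<partial>lborel)"
    by (rule nn_integral_cong) (auto simp: \<rho>_def indicator_def)
  also have "\<dots> = ennreal (exp ((\<mu> - \<kappa>) * t) * (\<psi> \<mu> x / \<psi> \<kappa> x)) *
      emeasure (distr P borel (\<lambda>w. w t)) B"
    unfolding PB by (rule doob_change_of_measure) (use nn x in auto)
  finally show ?thesis .
qed

end

section \<open>The determinantal martingale of independent diffusions\<close>

text \<open>Replaces an uncountable union over times by countable operations, so that a collision
  becomes an event of the past. The slack 1 / (m + 1) is there because \<open>f\<close> may reach 0
  only off the sampled times; the scaling \<open>q * u\<close> keeps one countable index set dense
  in \<open>{0..u}\<close>.\<close>

lemma continuous_nonneg_iff_rational:
  fixes f :: "real \<Rightarrow> real"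
  assumes u: "0 \<le> u" and f: "continuous_on {0..u} f"
  shows "(\<exists>v\<in>{0..u}. 0 \<le> f v) \<longleftrightarrow> (\<forall>m::nat. \<exists>q\<in>\<rat> \<inter> {0..1}. - (1 / Suc m) < f (q * u))"
proof
  assume "\<exists>v\<in>{0..u}. 0 \<le> f v"
  then obtain v where v: "0 \<le> v" "v \<le> u" "0 \<le> f v" by auto
  define w where "w = v / u"
  have w: "0 \<le> w" "w \<le> 1" "w * u = v"
    using u v by (auto simp: w_def divide_le_eq)
  have g: "continuous_on {0..1} (\<lambda>q. f (q * u))"
    by (rule continuous_on_compose2[OF f]) (use u in \<open>auto intro!: continuous_intros mult_left_le_one_le\<close>)
  show "\<forall>m::nat. \<exists>q\<in>\<rat> \<inter> {0..1}. - (1 / Suc m) < f (q * u)"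
  proof
    fix m :: nat
    obtain \<delta> where \<delta>: "0 < \<delta>"
      "\<And>q. q \<in> {0..1} \<Longrightarrow> \<bar>q - w\<bar> < \<delta> \<Longrightarrow> \<bar>f (q * u) - f (w * u)\<bar> < 1 / Suc m"
      using g[unfolded continuous_on_iff, rule_format, of w "1 / Suc m"] w
      by (auto simp: dist_real_def)
    have "max 0 (w - \<delta>) < min 1 (w + \<delta>)" using w \<delta> by auto
    then obtain q where q: "q \<in> \<rat>" "max 0 (w - \<delta>) < q" "q < min 1 (w + \<delta>)"
      using Rats_dense_in_real by blast
    then have "\<bar>f (q * u) - f (w * u)\<bar> < 1 / Suc m" by (intro \<delta>) auto
    moreover have "0 \<le> f (w * u)" using v w by simp
    ultimately have "- (1 / Suc m) < f (q * u)" by linarith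
    with q show "\<exists>q\<in>\<rat> \<inter> {0..1}. - (1 / Suc m) < f (q * u)" by auto
  qed
next
  assume R: "\<forall>m::nat. \<exists>q\<in>\<rat> \<inter> {0..1}. - (1 / Suc m) < f (q * u)"
  \<comment> \<open>On a compact interval the supremum is attained, so the slack can be sent to 0 at
    the one point \<open>v\<close>.\<close>
  obtain v where v: "v \<in> {0..u}" "\<And>w. w \<in> {0..u} \<Longrightarrow> f w \<le> f v"
    using continuous_attains_sup[OF compact_Icc _ f] u by auto
  have "- f v \<le> inverse (real (Suc m))" for m
  proof -
    obtain q where "0 \<le> q" "q \<le> 1" "- (1 / Suc m) < f (q * u)" using R by fastforce
    moreover from this have "f (q * u) \<le> f v"
      using u by (intro v) (auto intro!: mult_left_le_one_le)
    ultimately show ?thesis by (simp add: inverse_eq_divide)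
  qed
  then have "- f v \<le> 0"
    by (intro LIMSEQ_le_const[OF LIMSEQ_inverse_real_of_nat]) auto
  with v show "\<exists>v\<in>{0..u}. 0 \<le> f v" by auto
qed

text \<open>Let \<open>i\<close> be the first point moved by \<sigma>. All smaller values are taken
  by smaller points, so \<open>\<sigma> i\<close> exceeds \<open>i\<close>, and the point sent to
  \<open>i\<close> also lies above \<open>i\<close>; these two points form the inversion.\<close>

lemma permutes_ex_inversion:
  fixes \<sigma> :: "'n::{finite,linorder} \<Rightarrow> 'n"
  assumes \<sigma>: "\<sigma> permutes UNIV" and "\<sigma> \<noteq> id"
  shows "\<exists>a b. a < b \<and> \<sigma> b < \<sigma> a"
proof (rule ccontr)
  assume no: "\<not> ?thesis"
  have inj: "\<sigma> i = \<sigma> j \<longleftrightarrow> i = j" for i j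
    using permutes_inj[OF \<sigma>] by (auto dest: injD)
  define S where "S = {i. \<sigma> i \<noteq> i}"
  have "S \<noteq> {}" using assms(2) by (auto simp: S_def)
  then have "Min S \<in> S" by (intro Min_in) auto
  have below: "\<sigma> j = j" if "j < Min S" for j
  proof -
    have "j \<notin> S" using that by (meson Min_le finite not_le)
    then show ?thesis by (simp add: S_def)
  qed
  define i where "i = Min S"
  have i: "\<sigma> i \<noteq> i" using \<open>Min S \<in> S\<close> by (simp add: S_def i_def)
  then have "i < \<sigma> i"
    using below[of "\<sigma> i"] inj[of "\<sigma> i" i] by (cases "\<sigma> i < i") (auto simp: i_def)
  moreover obtain k where k: "\<sigma> k = i" using permutes_surj[OF \<sigma>] by (metis surjD)
  moreover have "i < k"
    using k i below[of k] by (cases i k rule: linorder_cases) (auto simp: i_def)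
  ultimately show False using no by auto
qed

text \<open>The Leibniz formula is applied to the transpose, because \<sigma> is to permute the
  parameters (rows) while the positions (columns) stay in place.\<close>

lemma det_quotient_Leibniz:
  fixes f :: "'n::finite \<Rightarrow> 'n \<Rightarrow> 'a::field"
  shows "(\<Sum>\<sigma> | \<sigma> permutes UNIV. of_int (sign \<sigma>) * (\<Prod>k\<in>UNIV. f (\<sigma> k) k / f k k)) =
    det (\<chi> i j. f i j) / (\<Prod>i\<in>UNIV. f i i)"
proof -
  have "det (\<chi> i j. f i j) = (\<Sum>\<sigma> | \<sigma> permutes UNIV. of_int (sign \<sigma>) * (\<Prod>k\<in>UNIV. f (\<sigma> k) k))"
    by (subst det_transpose[symmetric]) (simp add: det_def transpose_def)
  then show ?thesis
    by (simp add: sum_divide_distrib prod_dividef)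
qed

section \<open>Ratio martingales with respect to the joint past\<close>

locale independent_doob_diffusions = doob_transforms l r a b p \<psi> + prob_space M
  for l r :: ereal and a b :: "real \<Rightarrow> real" and p :: "real \<Rightarrow> real \<Rightarrow> real \<Rightarrow> real"
    and \<psi> :: "real \<Rightarrow> real \<Rightarrow> real" and M :: "'w measure" +
  fixes lam :: "'n::{finite,linorder} \<Rightarrow> real" and x :: "real ^ 'n::{finite,linorder}"
    and X :: "'n \<Rightarrow> real \<Rightarrow> 'w \<Rightarrow> real"
  assumes lam_nonneg: "\<forall>i. 0 \<le> lam i"
    and X: "\<forall>i. doob_diffusion l r a b p \<psi> (lam i) M (X i) (x $ i)"
    and independent: "indep_vars (\<lambda>i. \<Pi>\<^sub>M t\<in>{0..}. borel) (\<lambda>i \<omega>. \<lambda>t\<in>{0..}. X i t \<omega>) UNIV"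
begin

lemma X_markov: "markov_process l r (doob_density p (lam i) (\<psi> (lam i))) M (X i) (x $ i)"
  using X by (simp add: doob_diffusion_def diffusion_def)

lemma X_start: "\<omega> \<in> space M \<Longrightarrow> X i 0 \<omega> = x $ i"
  and X_cont: "\<omega> \<in> space M \<Longrightarrow> continuous_on {0..} (\<lambda>t. X i t \<omega>)"
  and X_range: "\<omega> \<in> space M \<Longrightarrow> 0 \<le> t \<Longrightarrow> X i t \<omega> \<in> einterval l r"
  using X_markov[of i] unfolding markov_process_def by blast+

lemma measurable_X: "0 \<le> v \<Longrightarrow> X i v \<in> borel_measurable M"
  using X_markov[of i] unfolding markov_process_def by blast

definition paths_upto :: "real \<Rightarrow> 'w \<Rightarrow> 'n \<Rightarrow> real \<Rightarrow> real" where
  "paths_upto s \<omega> = (\<lambda>i\<in>UNIV. \<lambda>v\<in>{0..s}. X i v \<omega>)"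

definition path_space :: "real \<Rightarrow> ('n \<Rightarrow> real \<Rightarrow> real) measure" where
  "path_space s = (\<Pi>\<^sub>M i\<in>UNIV. \<Pi>\<^sub>M v\<in>{0..s}. borel)"

text \<open>The natural filtration of all components together. As an inverse image, each of its
  events is a set of paths, the form in which the Markov property and independence are
  stated.\<close>

definition past :: "real \<Rightarrow> 'w measure" where
  "past s = vimage_algebra (space M) (paths_upto s) (path_space s)"

definition ratio :: "('n \<Rightarrow> 'n) \<Rightarrow> real \<Rightarrow> 'w \<Rightarrow> real" where
  "ratio \<sigma> t \<omega> = (\<Prod>k\<in>UNIV. \<psi> (lam (\<sigma> k)) (X k t \<omega>) / \<psi> (lam k) (X k t \<omega>))"

lemma space_past: "space (past s) = space M"
  by (simp add: past_def)

lemma measurable_paths_upto: "paths_upto s \<in> measurable M (path_space s)"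
  unfolding paths_upto_def path_space_def
  by (intro measurable_restrict measurable_X) auto

lemma sets_past: "sets (past s) = {paths_upto s -` A \<inter> space M | A. A \<in> sets (path_space s)}"
  unfolding past_def using measurable_space[OF measurable_paths_upto] by (intro sets_vimage_algebra2) auto

lemma sets_past_subset: "sets (past s) \<subseteq> sets M"
  using measurable_sets[OF measurable_paths_upto] by (auto simp: sets_past)

lemma measurable_X_past:
  assumes "0 \<le> v" "v \<le> s" shows "X i v \<in> borel_measurable (past s)"
proof -
  have "paths_upto s \<in> measurable (past s) (path_space s)"
    unfolding past_def using measurable_space[OF measurable_paths_upto] by (intro measurable_vimage_algebra1) auto
  moreover have "(\<lambda>\<phi>. \<phi> i) \<in> measurable (path_space s) (\<Pi>\<^sub>M v\<in>{0..s}. borel)"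
    unfolding path_space_def by (rule measurable_component_singleton) simp
  ultimately have "(\<lambda>\<omega>. paths_upto s \<omega> i) \<in> measurable (past s) (\<Pi>\<^sub>M v\<in>{0..s}. borel)"
    by (rule measurable_compose)
  moreover have "(\<lambda>w. w v) \<in> borel_measurable (\<Pi>\<^sub>M v\<in>{0..s}. (borel :: real measure))"
    by (rule measurable_component_singleton) (use assms in simp)
  ultimately have "(\<lambda>\<omega>. paths_upto s \<omega> i v) \<in> borel_measurable (past s)"
    by (rule measurable_compose)
  then show ?thesis
    using assms by (simp add: paths_upto_def)
qed

text \<open>Off the interval nothing is known about \<open>\<psi>\<close>, not even measurability; hence the indicator.\<close>

definition \<rho> :: "('n \<Rightarrow> 'n) \<Rightarrow> 'n \<Rightarrow> real \<Rightarrow> ennreal" where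
  "\<rho> \<sigma> k z = indicator (einterval l r) z * ennreal (\<psi> (lam (\<sigma> k)) z / \<psi> (lam k) z)"

lemma \<rho>_measurable[measurable]: "\<rho> \<sigma> k \<in> borel_measurable borel"
  unfolding \<rho>_def[abs_def] using psi_ratio_measurable lam_nonneg by auto

lemma \<rho>_X: "0 \<le> t \<Longrightarrow> \<omega> \<in> space M \<Longrightarrow>
    \<rho> \<sigma> k (X k t \<omega>) = ennreal (\<psi> (lam (\<sigma> k)) (X k t \<omega>) / \<psi> (lam k) (X k t \<omega>))"
  using X_range by (simp add: \<rho>_def)

lemma ratio_factor_pos: "0 \<le> t \<Longrightarrow> \<omega> \<in> space M \<Longrightarrow>
    0 < \<psi> (lam (\<sigma> k)) (X k t \<omega>) / \<psi> (lam k) (X k t \<omega>)"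
  using X_range psi_pos lam_nonneg by (intro divide_pos_pos) auto

lemma ratio_pos: "0 \<le> t \<Longrightarrow> \<omega> \<in> space M \<Longrightarrow> 0 < ratio \<sigma> t \<omega>"
  unfolding ratio_def by (intro prod_pos ratio_factor_pos ballI) auto

lemma ratio_ennreal:
  assumes "0 \<le> t" "\<omega> \<in> space M"
  shows "ennreal (ratio \<sigma> t \<omega>) = (\<Prod>k\<in>UNIV. \<rho> \<sigma> k (X k t \<omega>))"
proof -
  have "(\<Prod>k\<in>UNIV. \<rho> \<sigma> k (X k t \<omega>)) =
      (\<Prod>k\<in>UNIV. ennreal (\<psi> (lam (\<sigma> k)) (X k t \<omega>) / \<psi> (lam k) (X k t \<omega>)))"
    by (intro prod.cong refl \<rho>_X assms)
  also have "\<dots> = ennreal (ratio \<sigma> t \<omega>)"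
    unfolding ratio_def by (intro prod_ennreal less_imp_le ratio_factor_pos assms)
  finally show ?thesis ..
qed

lemma measurable_ratio_past: assumes "0 \<le> s" shows "ratio \<sigma> s \<in> borel_measurable (past s)"
proof -
  have [measurable]: "X k s \<in> borel_measurable (past s)" for k
    using measurable_X_past assms by auto
  have "(\<lambda>\<omega>. enn2real (\<Prod>k\<in>UNIV. \<rho> \<sigma> k (X k s \<omega>))) \<in> borel_measurable (past s)"
    by measurable
  moreover have "enn2real (\<Prod>k\<in>UNIV. \<rho> \<sigma> k (X k s \<omega>)) = ratio \<sigma> s \<omega>" if "\<omega> \<in> space (past s)" for \<omega>
    using that assms ratio_pos[of s \<omega> \<sigma>] by (simp add: space_past flip: ratio_ennreal)
  ultimately show ?thesis
    by (simp cong: measurable_cong)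
qed

lemma measurable_ratio: "0 \<le> s \<Longrightarrow> ratio \<sigma> s \<in> borel_measurable M"
  using measurable_sets[OF measurable_ratio_past[of s \<sigma>]] sets_past_subset[of s] space_past[of s]
  by (intro measurableI) auto

text \<open>Independence is assumed for entire paths on \<open>{0..}\<close>; each factor is a
  function of one such path, namely of its restriction to \<open>{0..s}\<close> and its value at
  \<open>t\<close>.\<close>

lemma nn_integral_prod_path:
  assumes s: "0 \<le> s" and t: "0 \<le> t" and A: "\<And>k. A k \<in> sets (\<Pi>\<^sub>M v\<in>{0..s}. (borel :: real measure))"
    and h[measurable]: "\<And>k. h k \<in> borel_measurable borel"
  shows "(\<integral>\<^sup>+\<omega>. (\<Prod>k\<in>UNIV. indicator (A k) (\<lambda>v\<in>{0..s}. X k v \<omega>) * h k (X k t \<omega>)) \<partial>M) =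
    (\<Prod>k\<in>UNIV. \<integral>\<^sup>+\<omega>. indicator (A k) (\<lambda>v\<in>{0..s}. X k v \<omega>) * h k (X k t \<omega>) \<partial>M)"
proof -
  define f where "f k w = (indicator (A k) (restrict w {0..s}) * h k (w t) :: ennreal)"
    for k and w :: "real \<Rightarrow> real"
  have f: "f k \<in> borel_measurable (\<Pi>\<^sub>M t\<in>{0..}. borel)" for k
  proof -
    note A[of k, measurable]
    have [measurable]: "(\<lambda>w. restrict w {0..s}) \<in>
        measurable (\<Pi>\<^sub>M t\<in>{0..}. (borel :: real measure)) (\<Pi>\<^sub>M v\<in>{0..s}. borel)"
      by (rule measurable_restrict_subset) auto
    have [measurable]: "(\<lambda>w. w t) \<in> borel_measurable (\<Pi>\<^sub>M t\<in>{0..}. (borel :: real measure))"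
      by (rule measurable_component_singleton) (use t in auto)
    show ?thesis unfolding f_def by measurable
  qed
  have restr: "restrict (\<lambda>t\<in>{0..}. X k t \<omega>) {0..s} = (\<lambda>v\<in>{0..s}. X k v \<omega>)" for k \<omega>
    by (auto simp: restrict_def)
  have f_eq: "f k (\<lambda>t\<in>{0..}. X k t \<omega>) = indicator (A k) (\<lambda>v\<in>{0..s}. X k v \<omega>) * h k (X k t \<omega>)" for k \<omega>
    unfolding f_def restr using t by simp
  have "indep_vars (\<lambda>_. borel) (\<lambda>k \<omega>. f k (\<lambda>t\<in>{0..}. X k t \<omega>)) UNIV"
    by (rule indep_vars_compose2[OF independent]) (rule f)
  from indep_vars_nn_integral[OF _ this] show ?thesis
    by (simp add: f_eq)
qed

text \<open>On a box, independence splits the expectation into one factor per component, and each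
  factor is governed by \<open>doob_diffusion_ratio_martingale\<close>.\<close>

lemma ratio_box:
  assumes \<sigma>: "\<sigma> permutes UNIV" and s: "0 \<le> s" and u: "0 \<le> u"
    and A: "\<And>k. A k \<in> sets (\<Pi>\<^sub>M v\<in>{0..s}. (borel :: real measure))"
  shows "(\<integral>\<^sup>+\<omega>. indicator (Pi\<^sub>E UNIV A) (paths_upto s \<omega>) * ennreal (ratio \<sigma> (s + u) \<omega>) \<partial>M) =
    (\<integral>\<^sup>+\<omega>. indicator (Pi\<^sub>E UNIV A) (paths_upto s \<omega>) * ennreal (ratio \<sigma> s \<omega>) \<partial>M)"
proof -
  have split: "(\<integral>\<^sup>+\<omega>. indicator (Pi\<^sub>E UNIV A) (paths_upto s \<omega>) * ennreal (ratio \<sigma> t \<omega>) \<partial>M) =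
      (\<Prod>k\<in>UNIV. \<integral>\<^sup>+\<omega>. indicator (A k) (\<lambda>v\<in>{0..s}. X k v \<omega>) *
        ennreal (\<psi> (lam (\<sigma> k)) (X k t \<omega>) / \<psi> (lam k) (X k t \<omega>)) \<partial>M)"
    if t: "0 \<le> t" for t
  proof -
    have ind: "indicator (Pi\<^sub>E UNIV A) (paths_upto s \<omega>) =
        (\<Prod>k\<in>UNIV. indicator (A k) (\<lambda>v\<in>{0..s}. X k v \<omega>) :: ennreal)" for \<omega>
    proof (cases "\<forall>k. (\<lambda>v\<in>{0..s}. X k v \<omega>) \<in> A k")
      case True
      then show ?thesis by (auto simp: paths_upto_def indicator_def PiE_def)
    next
      case False
      then obtain k where "(\<lambda>v\<in>{0..s}. X k v \<omega>) \<notin> A k" by blast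
      then have "(\<Prod>k\<in>UNIV. indicator (A k) (\<lambda>v\<in>{0..s}. X k v \<omega>) :: ennreal) = 0"
        by (intro prod_zero) (auto intro!: exI[of _ k])
      with False show ?thesis by (auto simp: paths_upto_def indicator_def PiE_def Pi_def)
    qed
    have "(\<integral>\<^sup>+\<omega>. indicator (Pi\<^sub>E UNIV A) (paths_upto s \<omega>) * ennreal (ratio \<sigma> t \<omega>) \<partial>M) =
      (\<integral>\<^sup>+\<omega>. (\<Prod>k\<in>UNIV. indicator (A k) (\<lambda>v\<in>{0..s}. X k v \<omega>) * \<rho> \<sigma> k (X k t \<omega>)) \<partial>M)"
      by (rule nn_integral_cong) (simp add: ind ratio_ennreal t prod.distrib)
    also have "\<dots> = (\<Prod>k\<in>UNIV. \<integral>\<^sup>+\<omega>. indicator (A k) (\<lambda>v\<in>{0..s}. X k v \<omega>) * \<rho> \<sigma> k (X k t \<omega>) \<partial>M)"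
      by (rule nn_integral_prod_path) (use s t A in auto)
    also have "\<dots> = (\<Prod>k\<in>UNIV. \<integral>\<^sup>+\<omega>. indicator (A k) (\<lambda>v\<in>{0..s}. X k v \<omega>) *
        ennreal (\<psi> (lam (\<sigma> k)) (X k t \<omega>) / \<psi> (lam k) (X k t \<omega>)) \<partial>M)"
      by (intro prod.cong refl nn_integral_cong) (simp add: \<rho>_X t)
    finally show ?thesis .
  qed
  \<comment> \<open>A permutation preserves the sum of the parameters, so the leftover exponentials
    multiply to 1.\<close>
  have "(\<Sum>k\<in>UNIV. (lam (\<sigma> k) - lam k) * u) = 0"
    using sum.permute[OF \<sigma>, of lam] by (simp add: sum_subtractf comp_def flip: sum_distrib_right)
  then have "(\<Prod>k\<in>UNIV. ennreal (exp ((lam (\<sigma> k) - lam k) * u))) = 1"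
    by (simp add: prod_ennreal flip: exp_sum)
  then show ?thesis
    unfolding split[OF s] split[OF add_nonneg_nonneg[OF s u]]
      doob_diffusion_ratio_martingale[OF X[rule_format] lam_nonneg[rule_format] lam_nonneg[rule_format] s u A]
      prod.distrib
    by simp
qed

text \<open>The whole space is a box at time 0, where the positions are \<open>x\<close>. The value
  being finite yields integrability and, later, the uniqueness of the measures compared on
  boxes.\<close>

lemma ratio_const_integral:
  assumes \<sigma>: "\<sigma> permutes UNIV" and t: "0 \<le> t"
  shows "(\<integral>\<^sup>+\<omega>. ennreal (ratio \<sigma> t \<omega>) \<partial>M) =
    ennreal (\<Prod>k\<in>UNIV. \<psi> (lam (\<sigma> k)) (x $ k) / \<psi> (lam k) (x $ k))"
proof -
  let ?S = "Pi\<^sub>E UNIV (\<lambda>_::'n. space (\<Pi>\<^sub>M v\<in>{0..0}. (borel :: real measure)))"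
  have in_S: "paths_upto 0 \<omega> \<in> ?S" for \<omega>
    by (auto simp: paths_upto_def space_PiM PiE_def extensional_def)
  have "(\<integral>\<^sup>+\<omega>. ennreal (ratio \<sigma> t \<omega>) \<partial>M) = (\<integral>\<^sup>+\<omega>. indicator ?S (paths_upto 0 \<omega>) * ennreal (ratio \<sigma> (0 + t) \<omega>) \<partial>M)"
    using in_S by (simp add: indicator_def)
  also have "\<dots> = (\<integral>\<^sup>+\<omega>. indicator ?S (paths_upto 0 \<omega>) * ennreal (ratio \<sigma> 0 \<omega>) \<partial>M)"
    by (rule ratio_box) (use \<sigma> t in auto)
  also have "\<dots> = (\<integral>\<^sup>+\<omega>. ennreal (\<Prod>k\<in>UNIV. \<psi> (lam (\<sigma> k)) (x $ k) / \<psi> (lam k) (x $ k)) \<partial>M)"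
    using in_S by (intro nn_integral_cong) (simp add: ratio_def X_start)
  finally show ?thesis by (simp add: emeasure_space_1)
qed

lemma ratio_integrable: "\<sigma> permutes UNIV \<Longrightarrow> 0 \<le> t \<Longrightarrow> integrable M (ratio \<sigma> t)"
  using ratio_const_integral[of \<sigma> t] measurable_ratio[of t \<sigma>] ratio_pos[of t _ \<sigma>, THEN less_imp_le]
  by (intro integrableI_nn_integral_finite) auto

text \<open>Boxes are stable under intersection and generate the joint path space, so finite
  measures that agree on boxes agree. They are applied to the laws of the paths up to
  \<open>s\<close>, weighted by the ratio at \<open>s\<close> and at \<open>t\<close>.\<close>

lemma ratio_nn_martingale:
  assumes \<sigma>: "\<sigma> permutes UNIV" and s: "0 \<le> s" and t: "s \<le> t" and A: "A \<in> sets (past s)"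
  shows "(\<integral>\<^sup>+\<omega>. indicator A \<omega> * ennreal (ratio \<sigma> s \<omega>) \<partial>M) =
    (\<integral>\<^sup>+\<omega>. indicator A \<omega> * ennreal (ratio \<sigma> t \<omega>) \<partial>M)"
proof -
  obtain H where H: "H \<in> sets (path_space s)" "A = paths_upto s -` H \<inter> space M"
    using A by (auto simp: sets_past)
  note measurable_paths_upto[of s, measurable]
  define P where "P t = distr (density M (\<lambda>\<omega>. ennreal (ratio \<sigma> t \<omega>))) (path_space s) (paths_upto s)" for t
  have P: "emeasure (P v) G = (\<integral>\<^sup>+\<omega>. indicator G (paths_upto s \<omega>) * ennreal (ratio \<sigma> v \<omega>) \<partial>M)"
    if G[measurable]: "G \<in> sets (path_space s)" and v: "0 \<le> v" for v G
  proof -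
    note measurable_ratio[OF v, measurable]
    show ?thesis
      unfolding P_def using measurable_sets[OF measurable_paths_upto[of s] G]
      by (auto simp: emeasure_distr emeasure_density indicator_def intro!: nn_integral_cong)
  qed
  have "P s = P t"
  proof (rule measure_eqI_PiM_finite[where A = "\<lambda>_. Pi\<^sub>E UNIV (\<lambda>_. space (\<Pi>\<^sub>M v\<in>{0..s}. borel))"])
    fix B :: "'n \<Rightarrow> (real \<Rightarrow> real) set"
    assume B: "\<And>i. i \<in> UNIV \<Longrightarrow> B i \<in> sets (\<Pi>\<^sub>M v\<in>{0..s}. borel)"
    then have "Pi\<^sub>E UNIV B \<in> sets (path_space s)"
      unfolding path_space_def by (intro sets_PiM_I_finite) auto
    with ratio_box[OF \<sigma> s, of "t - s" B] B s t
    show "emeasure (P s) (Pi\<^sub>E UNIV B) = emeasure (P t) (Pi\<^sub>E UNIV B)"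
      by (simp add: P)
  next
    let ?S = "Pi\<^sub>E UNIV (\<lambda>_::'n. space (\<Pi>\<^sub>M v\<in>{0..s}. (borel :: real measure)))"
    have S: "?S = space (path_space s)" by (simp add: path_space_def space_PiM)
    show "(\<Union>i::nat. ?S) = space (\<Pi>\<^sub>M i\<in>UNIV. \<Pi>\<^sub>M v\<in>{0..s}. borel)"
      by (simp add: space_PiM)
    show "range (\<lambda>_::nat. ?S) \<subseteq> prod_algebra UNIV (\<lambda>_. \<Pi>\<^sub>M v\<in>{0..s}. borel)"
      by (auto intro!: prod_algebraI_finite)
    have "emeasure (P s) ?S = (\<integral>\<^sup>+\<omega>. ennreal (ratio \<sigma> s \<omega>) \<partial>M)"
      unfolding S using measurable_space[OF measurable_paths_upto[of s]] s
      by (subst P) (auto simp: indicator_def intro!: nn_integral_cong)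
    then show "emeasure (P s) ?S \<noteq> \<infinity>"
      using ratio_const_integral[OF \<sigma> s] by simp
  qed (auto simp: P_def path_space_def)
  have "(\<integral>\<^sup>+\<omega>. indicator A \<omega> * ennreal (ratio \<sigma> v \<omega>) \<partial>M) = emeasure (P v) H" if v: "0 \<le> v" for v
    unfolding P[OF H(1) v] H(2) by (rule nn_integral_cong) (auto simp: indicator_def)
  from this[of s] this[of t] s t show ?thesis
    unfolding \<open>P s = P t\<close> by simp
qed

lemma ratio_martingale:
  assumes \<sigma>: "\<sigma> permutes UNIV" and s: "0 \<le> s" and t: "s \<le> t" and A: "A \<in> sets (past s)"
  shows "(\<integral>\<omega>. indicator A \<omega> * ratio \<sigma> s \<omega> \<partial>M) = (\<integral>\<omega>. indicator A \<omega> * ratio \<sigma> t \<omega> \<partial>M)"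
proof -
  have [measurable]: "A \<in> sets M" using A sets_past_subset by blast
  have "(\<integral>\<omega>. indicator A \<omega> * ratio \<sigma> v \<omega> \<partial>M) =
     enn2real (\<integral>\<^sup>+\<omega>. indicator A \<omega> * ennreal (ratio \<sigma> v \<omega>) \<partial>M)" if v: "0 \<le> v" for v
  proof -
    note measurable_ratio[OF v, measurable]
    have "(\<integral>\<omega>. indicator A \<omega> * ratio \<sigma> v \<omega> \<partial>M) =
       enn2real (\<integral>\<^sup>+\<omega>. ennreal (indicator A \<omega> * ratio \<sigma> v \<omega>) \<partial>M)"
      using ratio_pos[OF v, THEN less_imp_le]
      by (intro integral_eq_nn_integral AE_I2) auto
    also have "(\<integral>\<^sup>+\<omega>. ennreal (indicator A \<omega> * ratio \<sigma> v \<omega>) \<partial>M) =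
        (\<integral>\<^sup>+\<omega>. indicator A \<omega> * ennreal (ratio \<sigma> v \<omega>) \<partial>M)"
      by (rule nn_integral_cong) (auto simp: indicator_def)
    finally show ?thesis .
  qed
  with ratio_nn_martingale[OF assms] s t show ?thesis by simp
qed

end

section \<open>The determinantal quotient up to the first collision\<close>

locale noncolliding_doob_diffusions = independent_doob_diffusions l r a b p \<psi> M lam x X
  for l r :: ereal and a b :: "real \<Rightarrow> real" and p :: "real \<Rightarrow> real \<Rightarrow> real \<Rightarrow> real"
    and \<psi> :: "real \<Rightarrow> real \<Rightarrow> real" and M :: "'w measure"
    and lam :: "'n::{finite,linorder} \<Rightarrow> real" and x :: "real ^ 'n::{finite,linorder}"
    and X :: "'n \<Rightarrow> real \<Rightarrow> 'w \<Rightarrow> real" +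
  assumes AO: "condition_AO l r a b p \<psi>"
    and lam_mono: "strict_mono lam"
    and x_chamber: "x \<in> weyl_chamber l r"
begin

text \<open>Taken as a Leibniz sum so that integrability and the martingale identity pass term by
  term from the ratios; \<open>det_quotient_eq\<close> recovers the determinant.\<close>

definition det_quotient :: "real \<Rightarrow> 'w \<Rightarrow> real" where
  "det_quotient t \<omega> = (\<Sum>\<sigma> | \<sigma> permutes UNIV. of_int (sign \<sigma>) * ratio \<sigma> t \<omega>)"

text \<open>Having collided is encoded by a weak inequality in the wrong order. As the paths stay in
  the interval, this means having left the chamber, and it is a closed condition, so that a first
  such time exists.\<close>

definition collided :: "real \<Rightarrow> 'w set" where
  "collided u = {\<omega>\<in>space M. \<exists>i j. i < j \<and> (\<exists>v\<in>{0..u}. 0 \<le> X i v \<omega> - X j v \<omega>)}"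

lemma det_quotient_eq: "det_quotient t \<omega> = det (\<chi> i j. \<psi> (lam i) (X j t \<omega>)) / (\<Prod>i\<in>UNIV. \<psi> (lam i) (X i t \<omega>))"
  unfolding det_quotient_def ratio_def using det_quotient_Leibniz[of "\<lambda>i j. \<psi> (lam i) (X j t \<omega>)"] by simp

text \<open>Equal positions give the matrix two equal columns.\<close>

lemma det_quotient_collision:
  assumes "i \<noteq> j" "X i t \<omega> = X j t \<omega>" shows "det_quotient t \<omega> = 0"
proof -
  have "det (\<chi> i j. \<psi> (lam i) (X j t \<omega>)) = 0"
    by (rule det_identical_columns[OF assms(1)]) (simp add: column_def assms(2))
  then show ?thesis by (simp add: det_quotient_eq)
qed

lemma det_quotient_integrable: "0 \<le> t \<Longrightarrow> integrable M (det_quotient t)"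
  unfolding det_quotient_def[abs_def] by (intro Bochner_Integration.integrable_sum integrable_mult_right ratio_integrable) auto

lemma det_quotient_integral_indicator:
  assumes "0 \<le> t" "A \<in> sets M"
  shows "(\<integral>\<omega>. indicator A \<omega> * det_quotient t \<omega> \<partial>M) =
    (\<Sum>\<sigma> | \<sigma> permutes UNIV. of_int (sign \<sigma>) * (\<integral>\<omega>. indicator A \<omega> * ratio \<sigma> t \<omega> \<partial>M))"
proof -
  have "(\<integral>\<omega>. indicator A \<omega> * det_quotient t \<omega> \<partial>M) =
    (\<integral>\<omega>. (\<Sum>\<sigma> | \<sigma> permutes UNIV. of_int (sign \<sigma>) * (indicator A \<omega> * ratio \<sigma> t \<omega>)) \<partial>M)"
    by (simp add: det_quotient_def sum_distrib_left mult.left_commute)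
  also have "\<dots> = (\<Sum>\<sigma> | \<sigma> permutes UNIV. (\<integral>\<omega>. of_int (sign \<sigma>) * (indicator A \<omega> * ratio \<sigma> t \<omega>) \<partial>M))"
    using integrable_mult_indicator[OF assms(2) ratio_integrable[OF _ assms(1)]]
    by (intro Bochner_Integration.integral_sum integrable_mult_right) auto
  finally show ?thesis by simp
qed

lemma det_quotient_cont:
  assumes "\<omega> \<in> space M" shows "continuous_on {0..t} (\<lambda>s. det_quotient s \<omega>)"
proof -
  have "continuous_on {0..t} (\<lambda>s. \<psi> (lam i) (X k s \<omega>))" for i k
    by (rule continuous_on_compose2[OF psi_cont continuous_on_subset[OF X_cont]])
       (use lam_nonneg assms X_range in auto)
  moreover have "\<psi> (lam k) (X k s \<omega>) \<noteq> 0" if "s \<in> {0..t}" for k s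
    using psi_pos[of "lam k" "X k s \<omega>"] X_range[of \<omega> s k] assms that lam_nonneg by fastforce
  ultimately show ?thesis
    unfolding det_quotient_def ratio_def by (intro continuous_intros) auto
qed

lemma collided_in_past:
  assumes "0 \<le> u" "u \<le> s" shows "collided u \<in> sets (past s)"
proof -
  have c: "continuous_on {0..u} (\<lambda>v. X i v \<omega> - X j v \<omega>)" if "\<omega> \<in> space M" for i j \<omega>
    by (intro continuous_on_diff continuous_on_subset[OF X_cont[OF that]]) auto
  have "collided u = {\<omega>\<in>space (past s). \<exists>i j. i < j \<and>
      (\<forall>m::nat. \<exists>q\<in>\<rat> \<inter> {0..1}. - (1 / Suc m) < X i (q * u) \<omega> - X j (q * u) \<omega>)}"
    unfolding collided_def space_past
    by (intro Collect_cong conj_cong ex_cong1 refl continuous_nonneg_iff_rational[OF assms(1) c])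
  also have "\<dots> \<in> sets (past s)"
  proof (intro sets.sets_Collect_countable_Ex' sets.sets_Collect_countable_Ex
      sets.sets_Collect_countable_All sets.sets_Collect)
    fix i j :: 'n and m :: nat and q :: real assume q: "q \<in> \<rat> \<inter> {0..1}"
    have "q * u \<le> 1 * s" using q assms by (intro mult_mono) auto
    then have [measurable]: "X k (q * u) \<in> borel_measurable (past s)" for k
      using q assms by (intro measurable_X_past) auto
    show "{\<omega>\<in>space (past s). - (1 / Suc m) < X i (q * u) \<omega> - X j (q * u) \<omega>} \<in> sets (past s)"
      by measurable
  qed (auto intro: countable_Int1 countable_rat)
  finally show ?thesis .
qed

lemma collided_mono: "u \<le> t \<Longrightarrow> collided u \<subseteq> collided t"
  by (fastforce simp: collided_def)

text \<open>Supplies the time at which the martingale is stopped: the least time at which some pair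
  is weakly out of order. From a strictly ordered start, continuous paths can get there only through
  equality.\<close>

lemma collided_debut:
  assumes \<omega>: "\<omega> \<in> collided t"
  shows "\<exists>\<tau>\<in>{0..t}. det_quotient \<tau> \<omega> = 0 \<and> (\<forall>u\<in>{0..t}. \<omega> \<in> collided u \<longleftrightarrow> \<tau> \<le> u)"
proof -
  have \<omega>M: "\<omega> \<in> space M" using \<omega> by (simp add: collided_def)
  define T where "T i j = {v\<in>{0..t}. X i v \<omega> - X j v \<omega> \<in> {0..}}" for i j
  define S where "S = (\<Union>(i, j)\<in>{(i, j). i < j}. T i j)"
  have c: "continuous_on {0..u} (\<lambda>v. X i v \<omega> - X j v \<omega>)" for i j u
    by (intro continuous_on_diff continuous_on_subset[OF X_cont[OF \<omega>M]]) auto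
  have "closed (T i j)" for i j
    unfolding T_def
    using continuous_closed_preimage[OF c[of t i j] closed_real_atLeastAtMost closed_atLeast[of 0]]
    by (simp add: vimage_def Int_def)
  then have S: "closed S"
    unfolding S_def by (intro closed_UN) auto
  have S_sub: "S \<subseteq> {0..t}" by (auto simp: S_def T_def)
  then have bdd: "bdd_below S" by (meson bdd_below_Icc bdd_below_mono)
  have "S \<noteq> {}" using \<omega> by (force simp: collided_def S_def T_def)
  define \<tau> where "\<tau> = Inf S"
  have \<tau>S: "\<tau> \<in> S"
    unfolding \<tau>_def by (rule closed_contains_Inf) fact+
  have least: "\<tau> \<le> v" if "v \<in> S" for v
    unfolding \<tau>_def using that bdd by (rule cInf_lower)
  have \<tau>: "0 \<le> \<tau>" "\<tau> \<le> t" using \<tau>S S_sub by auto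
  obtain i j where ij: "i < j" "0 \<le> X i \<tau> \<omega> - X j \<tau> \<omega>"
    using \<tau>S by (auto simp: S_def T_def)
  have "X i 0 \<omega> - X j 0 \<omega> < 0"
    using x_chamber ij(1) by (simp add: X_start[OF \<omega>M] weyl_chamber_def)
  \<comment> \<open>At \<tau> the pair is so far only weakly out of order. The intermediate value
    theorem finds equality no later than \<tau>, and minimality forces that time to be
    \<tau>.\<close>
  then obtain v where v: "0 \<le> v" "v \<le> \<tau>" "X i v \<omega> - X j v \<omega> = 0"
    using IVT'[of "\<lambda>v. X i v \<omega> - X j v \<omega>" 0 0 \<tau>] c ij \<tau> by auto
  then have "v \<in> S" using ij(1) \<tau> by (force simp: S_def T_def)
  with v least have "v = \<tau>" by force
  with v have "det_quotient \<tau> \<omega> = 0" using ij(1) by (intro det_quotient_collision[of i j]) auto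
  moreover have "\<omega> \<in> collided u \<longleftrightarrow> \<tau> \<le> u" if u: "u \<in> {0..t}" for u
  proof
    assume "\<omega> \<in> collided u"
    then obtain i j v where "i < j" "0 \<le> v" "v \<le> u" "0 \<le> X i v \<omega> - X j v \<omega>"
      by (auto simp: collided_def)
    moreover from this have "v \<in> S" using u by (force simp: S_def T_def)
    ultimately show "\<tau> \<le> u" using least by force
  next
    assume "\<tau> \<le> u"
    with ij \<tau> \<omega>M show "\<omega> \<in> collided u" by (force simp: collided_def)
  qed
  ultimately show ?thesis using \<tau> by auto
qed

lemma det_quotient_stopped:
  assumes t: "0 < t"
  shows "(\<integral>\<omega>. indicator (collided t) \<omega> * det_quotient t \<omega> \<partial>M) = 0"
proof (rule stopped_martingale_zero[where F = past])
  fix s A assume s: "0 \<le> s" "s \<le> t" and A: "A \<in> sets (past s)"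
  then show "(\<integral>\<omega>. indicator A \<omega> * det_quotient s \<omega> \<partial>M) = (\<integral>\<omega>. indicator A \<omega> * det_quotient t \<omega> \<partial>M)"
    using sets_past_subset[of s] t
    by (subst (1 2) det_quotient_integral_indicator) (auto intro!: sum.cong simp: ratio_martingale)
next
  fix s :: real assume "0 \<le> s"
  then show "det_quotient s \<in> borel_measurable (past s)"
    unfolding det_quotient_def[abs_def]
    by (intro borel_measurable_sum borel_measurable_times borel_measurable_const measurable_ratio_past)
qed (use t in \<open>auto intro: det_quotient_integrable det_quotient_cont collided_in_past collided_debut dest: collided_mono subsetD[OF sets_past_subset] simp: space_past\<close>)

text \<open>Optional stopping removes the collided part, and on the whole space the martingale may
  be read at time 0, where it is constant.\<close>

lemma det_quotient_integral_no_collision: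
  assumes t: "0 < t"
  shows "(\<integral>\<omega>. indicator (space M - collided t) \<omega> * det_quotient t \<omega> \<partial>M) =
    det (\<chi> i j. \<psi> (lam i) (x $ j)) / (\<Prod>i\<in>UNIV. \<psi> (lam i) (x $ i))"
proof -
  have [measurable]: "collided t \<in> sets M" using collided_in_past[of t t] sets_past_subset t by auto
  have S: "space M \<in> sets (past 0)" using sets.top[of "past 0"] by (simp add: space_past)
  have int: "integrable M (\<lambda>\<omega>. indicator A \<omega> * det_quotient t \<omega>)" if "A \<in> sets M" for A
    using integrable_mult_indicator[OF that det_quotient_integrable] t by simp
  have "(\<integral>\<omega>. indicator (space M - collided t) \<omega> * det_quotient t \<omega> \<partial>M) =
      (\<integral>\<omega>. indicator (space M) \<omega> * det_quotient t \<omega> - indicator (collided t) \<omega> * det_quotient t \<omega> \<partial>M)"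
    by (rule Bochner_Integration.integral_cong) (auto simp: indicator_def collided_def)
  also have "\<dots> = (\<integral>\<omega>. indicator (space M) \<omega> * det_quotient t \<omega> \<partial>M) - (\<integral>\<omega>. indicator (collided t) \<omega> * det_quotient t \<omega> \<partial>M)"
    by (intro Bochner_Integration.integral_diff int) auto
  also have "\<dots> = (\<integral>\<omega>. indicator (space M) \<omega> * det_quotient t \<omega> \<partial>M)"
    using det_quotient_stopped[OF t] by simp
  also have "\<dots> = (\<integral>\<omega>. indicator (space M) \<omega> * det_quotient 0 \<omega> \<partial>M)"
    using t ratio_martingale[OF _ _ _ S, of _ t]
    by (subst (1 2) det_quotient_integral_indicator) auto
  also have "\<dots> = (\<integral>\<omega>. det (\<chi> i j. \<psi> (lam i) (x $ j)) / (\<Prod>i\<in>UNIV. \<psi> (lam i) (x $ i)) \<partial>M)"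
    by (rule Bochner_Integration.integral_cong) (auto simp: det_quotient_eq X_start)
  finally show ?thesis by (simp add: prob_space)
qed

section \<open>Long-time limit under permuted parameters\<close>

text \<open>Divided by its initial value, the ratio is the density of a measure under which the
  positions at \<open>t\<close> are again independent, the \<open>k\<close>-th now with parameter
  \<open>lam (\<sigma> k)\<close>.\<close>

lemma ratio_joint_law:
  assumes \<sigma>: "\<sigma> permutes UNIV" and P: "\<And>k. doob_path_law l r a b p \<psi> (lam (\<sigma> k)) (x $ k) (P k)"
    and t: "0 < t" and D[measurable]: "\<And>k. D k \<in> sets borel"
  shows "(\<integral>\<^sup>+\<omega>. ennreal (ratio \<sigma> t \<omega>) * (\<Prod>k\<in>UNIV. indicator (D k) (X k t \<omega>)) \<partial>M) =
    ennreal (\<Prod>k\<in>UNIV. \<psi> (lam (\<sigma> k)) (x $ k) / \<psi> (lam k) (x $ k)) *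
    (\<Prod>k\<in>UNIV. emeasure (distr (P k) borel (\<lambda>w. w t)) (D k))"
proof -
  let ?U = "\<lambda>_::'n. space (\<Pi>\<^sub>M v\<in>{0..0}. (borel :: real measure))"
  have U: "(\<lambda>v\<in>{0..0}. X k v \<omega>) \<in> ?U k" for k \<omega>
    by (simp add: space_PiM)
  have pos: "0 < \<psi> (lam (\<sigma> k)) (x $ k) / \<psi> (lam k) (x $ k)" for k
    using psi_pos lam_nonneg x_chamber by (intro divide_pos_pos) (auto simp: weyl_chamber_def)
  have "(\<integral>\<^sup>+\<omega>. ennreal (ratio \<sigma> t \<omega>) * (\<Prod>k\<in>UNIV. indicator (D k) (X k t \<omega>)) \<partial>M) =
    (\<integral>\<^sup>+\<omega>. (\<Prod>k\<in>UNIV. indicator (?U k) (\<lambda>v\<in>{0..0}. X k v \<omega>) *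
        (\<rho> \<sigma> k (X k t \<omega>) * indicator (D k) (X k t \<omega>))) \<partial>M)"
    using t U by (intro nn_integral_cong) (simp add: ratio_ennreal prod.distrib)
  also have "\<dots> = (\<Prod>k\<in>UNIV. \<integral>\<^sup>+\<omega>. indicator (?U k) (\<lambda>v\<in>{0..0}. X k v \<omega>) *
        (\<rho> \<sigma> k (X k t \<omega>) * indicator (D k) (X k t \<omega>)) \<partial>M)"
    by (rule nn_integral_prod_path[where h = "\<lambda>k z. \<rho> \<sigma> k z * indicator (D k) z"]) (use t in auto)
  also have "\<dots> = (\<Prod>k\<in>UNIV. \<integral>\<^sup>+\<omega>. ennreal (\<psi> (lam (\<sigma> k)) (X k t \<omega>) / \<psi> (lam k) (X k t \<omega>)) *
        indicator (D k) (X k t \<omega>) \<partial>M)"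
    using t U by (intro prod.cong refl nn_integral_cong) (simp add: \<rho>_X)
  also have "\<dots> = (\<Prod>k\<in>UNIV. ennreal (exp ((lam (\<sigma> k) - lam k) * t) *
      (\<psi> (lam (\<sigma> k)) (x $ k) / \<psi> (lam k) (x $ k))) * emeasure (distr (P k) borel (\<lambda>w. w t)) (D k))"
    by (intro prod.cong refl doob_diffusion_ratio_law[OF X[rule_format] P
          lam_nonneg[rule_format] lam_nonneg[rule_format] t D])
  also have "\<dots> = (\<Prod>k\<in>UNIV. ennreal (exp ((lam (\<sigma> k) - lam k) * t) *
      (\<psi> (lam (\<sigma> k)) (x $ k) / \<psi> (lam k) (x $ k)))) *
      (\<Prod>k\<in>UNIV. emeasure (distr (P k) borel (\<lambda>w. w t)) (D k))"
    by (rule prod.distrib)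
  also have "(\<Prod>k\<in>UNIV. ennreal (exp ((lam (\<sigma> k) - lam k) * t) *
      (\<psi> (lam (\<sigma> k)) (x $ k) / \<psi> (lam k) (x $ k)))) =
      ennreal (\<Prod>k\<in>UNIV. exp ((lam (\<sigma> k) - lam k) * t) *
      (\<psi> (lam (\<sigma> k)) (x $ k) / \<psi> (lam k) (x $ k)))"
    using pos by (intro prod_ennreal mult_nonneg_nonneg) (auto intro: less_imp_le)
  also have "(\<Prod>k\<in>UNIV. exp ((lam (\<sigma> k) - lam k) * t) *
      (\<psi> (lam (\<sigma> k)) (x $ k) / \<psi> (lam k) (x $ k))) =
      exp (\<Sum>k\<in>UNIV. (lam (\<sigma> k) - lam k) * t) * (\<Prod>k\<in>UNIV. \<psi> (lam (\<sigma> k)) (x $ k) / \<psi> (lam k) (x $ k))"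
    unfolding prod.distrib by (simp add: exp_sum)
  also have "(\<Sum>k\<in>UNIV. (lam (\<sigma> k) - lam k) * t) = 0"
    using sum.permute[OF \<sigma>, of lam] by (simp add: sum_subtractf comp_def flip: sum_distrib_right)
  finally show ?thesis by simp
qed

text \<open>\<open>P j\<close> comes first because (AO) puts its path below when
  \<open>lam (\<sigma> j) < lam (\<sigma> i)\<close>. The event on the left corresponds to the
  opposite order, hence to a part of the complement.\<close>

lemma ratio_inversion_bound:
  assumes \<sigma>: "\<sigma> permutes UNIV" and P: "\<And>k. doob_path_law l r a b p \<psi> (lam (\<sigma> k)) (x $ k) (P k)"
    and t: "0 < t" and ij: "i \<noteq> j"
  shows "(\<integral>\<^sup>+\<omega>. indicator {\<omega>\<in>space M. X i t \<omega> < X j t \<omega>} \<omega> * ennreal (ratio \<sigma> t \<omega>) \<partial>M) \<le>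
    ennreal ((\<Prod>k\<in>UNIV. \<psi> (lam (\<sigma> k)) (x $ k) / \<psi> (lam k) (x $ k)) *
      (1 - measure (P j \<Otimes>\<^sub>M P i) {(w1, w2) \<in> space (P j \<Otimes>\<^sub>M P i). w1 t < w2 t}))"
proof -
  define c where "c = (\<Prod>k\<in>UNIV. \<psi> (lam (\<sigma> k)) (x $ k) / \<psi> (lam k) (x $ k))"
  have c: "0 < c"
    unfolding c_def using psi_pos lam_nonneg x_chamber
    by (intro prod_pos ballI divide_pos_pos) (auto simp: weyl_chamber_def)
  have Pm: "markov_process l r (doob_density p (lam (\<sigma> k)) (\<psi> (lam (\<sigma> k)))) (P k) (\<lambda>t w. w t) (x $ k)" for k
    using P[of k] by (simp add: doob_path_law_def doob_diffusion_def diffusion_def)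
  then have Pp: "prob_space (P k)" for k by (simp add: markov_process_def)
  have [measurable]: "(\<lambda>w. w t) \<in> borel_measurable (P k)" for k
    using Pm[of k] t unfolding markov_process_def by (meson less_imp_le)
  define \<nu> where "\<nu> k = distr (P k) borel (\<lambda>w. w t)" for k
  have \<nu>p: "prob_space (\<nu> k)" for k
    unfolding \<nu>_def by (intro prob_space.prob_space_distr Pp) measurable
  have [measurable]: "X k t \<in> borel_measurable M" for k using measurable_X t by simp
  have [measurable]: "ratio \<sigma> t \<in> borel_measurable M" using measurable_ratio t by simp
  \<comment> \<open>The joint law of the two positions under the weighted measure; dividing by the
    initial value \<open>c\<close> makes it a probability.\<close>
  define N where "N = distr (density M (\<lambda>\<omega>. ennreal (ratio \<sigma> t \<omega> / c))) (borel \<Otimes>\<^sub>M borel)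
      (\<lambda>\<omega>. (X j t \<omega>, X i t \<omega>))"
  have N: "emeasure N G = (\<integral>\<^sup>+\<omega>. ennreal (ratio \<sigma> t \<omega> / c) * indicator G (X j t \<omega>, X i t \<omega>) \<partial>M)"
    if [measurable]: "G \<in> sets (borel \<Otimes>\<^sub>M borel)" for G
  proof -
    have "(\<lambda>\<omega>. (X j t \<omega>, X i t \<omega>)) -` G \<inter> space M \<in> sets M" by measurable
    then show ?thesis
      unfolding N_def
      by (auto simp: emeasure_distr emeasure_density indicator_def intro!: nn_integral_cong)
  qed
  have cancel: "ennreal (ratio \<sigma> t \<omega>) = ennreal c * ennreal (ratio \<sigma> t \<omega> / c)" if "\<omega> \<in> space M" for \<omega>
    using c ratio_pos[of t \<omega> \<sigma>] t that by (simp flip: ennreal_mult')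
  have "\<nu> j \<Otimes>\<^sub>M \<nu> i = N"
  proof (rule pair_measure_eqI)
    show "sigma_finite_measure (\<nu> j)" "sigma_finite_measure (\<nu> i)"
      by (intro prob_space_imp_sigma_finite \<nu>p)+
    show "sets (\<nu> j \<Otimes>\<^sub>M \<nu> i) = sets N"
      by (simp add: N_def \<nu>_def cong: sets_pair_measure_cong)
    fix A B assume "A \<in> sets (\<nu> j)" "B \<in> sets (\<nu> i)"
    then have [measurable]: "A \<in> sets borel" "B \<in> sets borel" by (auto simp: \<nu>_def)
    \<comment> \<open>Only the \<open>i\<close>-th and \<open>j\<close>-th positions are
      constrained; the other marginals contribute their total mass 1.\<close>
    define D where "D k = (if k = j then A else if k = i then B else UNIV)" for k
    have D[measurable]: "D k \<in> sets borel" for k by (simp add: D_def)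
    have two: "(\<Prod>k\<in>UNIV. f k) = f j * f i" if "\<And>k. k \<noteq> i \<Longrightarrow> k \<noteq> j \<Longrightarrow> f k = 1" for f :: "'n \<Rightarrow> ennreal"
    proof -
      have "(\<Prod>k\<in>UNIV. f k) = (\<Prod>k\<in>{j, i}. f k)"
        by (rule prod.mono_neutral_right) (use that in auto)
      with ij show ?thesis by simp
    qed
    have "ennreal c * emeasure N (A \<times> B) =
        (\<integral>\<^sup>+\<omega>. ennreal c * (ennreal (ratio \<sigma> t \<omega> / c) * indicator (A \<times> B) (X j t \<omega>, X i t \<omega>)) \<partial>M)"
      by (subst N) (measurable, rule nn_integral_cmult[symmetric], measurable)
    also have "\<dots> = (\<integral>\<^sup>+\<omega>. ennreal (ratio \<sigma> t \<omega>) * (\<Prod>k\<in>UNIV. indicator (D k) (X k t \<omega>)) \<partial>M)"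
    proof (rule nn_integral_cong)
      fix \<omega> assume \<omega>: "\<omega> \<in> space M"
      have "(\<Prod>k\<in>UNIV. indicator (D k) (X k t \<omega>) :: ennreal) = indicator (A \<times> B) (X j t \<omega>, X i t \<omega>)"
        using ij by (subst two) (auto simp: D_def indicator_def)
      then show "ennreal c * (ennreal (ratio \<sigma> t \<omega> / c) * indicator (A \<times> B) (X j t \<omega>, X i t \<omega>)) =
          ennreal (ratio \<sigma> t \<omega>) * (\<Prod>k\<in>UNIV. indicator (D k) (X k t \<omega>))"
        by (simp add: cancel[OF \<omega>] mult.assoc)
    qed
    also have "\<dots> = ennreal c * (\<Prod>k\<in>UNIV. emeasure (\<nu> k) (D k))"
      unfolding c_def \<nu>_def by (rule ratio_joint_law[OF \<sigma> P t D])
    also have "(\<Prod>k\<in>UNIV. emeasure (\<nu> k) (D k)) = emeasure (\<nu> j) A * emeasure (\<nu> i) B"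
    proof (subst two)
      fix k assume "k \<noteq> i" "k \<noteq> j"
      then show "emeasure (\<nu> k) (D k) = 1"
        using prob_space.emeasure_space_1[OF \<nu>p[of k]] by (simp add: D_def \<nu>_def)
    qed (use ij in \<open>simp add: D_def\<close>)
    finally show "emeasure (\<nu> j) A * emeasure (\<nu> i) B = emeasure N (A \<times> B)"
      using c by (simp add: ennreal_mult_cancel_left)
  qed
  moreover have "\<nu> j \<Otimes>\<^sub>M \<nu> i = distr (P j \<Otimes>\<^sub>M P i) (borel \<Otimes>\<^sub>M borel) (\<lambda>(w1, w2). (w1 t, w2 t))"
    unfolding \<nu>_def
    by (intro pair_measure_distr prob_space_imp_sigma_finite prob_space.prob_space_distr Pp) measurable
  ultimately have Nd: "N = distr (P j \<Otimes>\<^sub>M P i) (borel \<Otimes>\<^sub>M borel) (\<lambda>(w1, w2). (w1 t, w2 t))"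
    by simp
  interpret Q: prob_space "P j \<Otimes>\<^sub>M P i"
    using Pp by (intro prob_space_pair)
  let ?L = "{(w1, w2) \<in> space (P j \<Otimes>\<^sub>M P i). w1 t < w2 t}"
  let ?G = "{(w1, w2) \<in> space (P j \<Otimes>\<^sub>M P i). w2 t < w1 t}"
  have L: "?L \<in> sets (P j \<Otimes>\<^sub>M P i)" and G: "?G \<in> sets (P j \<Otimes>\<^sub>M P i)"
    by (simp_all add: case_prod_unfold)
  have gt: "{(y, z). z < y} \<in> sets (borel \<Otimes>\<^sub>M (borel :: real measure))"
    using borel_measurable_less[of snd "borel \<Otimes>\<^sub>M borel" fst]
    by (simp add: case_prod_unfold space_pair_measure)
  have "(\<integral>\<^sup>+\<omega>. indicator {\<omega>\<in>space M. X i t \<omega> < X j t \<omega>} \<omega> * ennreal (ratio \<sigma> t \<omega>) \<partial>M) =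
      (\<integral>\<^sup>+\<omega>. ennreal c * (ennreal (ratio \<sigma> t \<omega> / c) * indicator {(y, z). z < y} (X j t \<omega>, X i t \<omega>)) \<partial>M)"
    by (rule nn_integral_cong) (auto simp: cancel indicator_def)
  also have "\<dots> = ennreal c * emeasure N {(y, z). z < y}"
    unfolding N[OF gt] by (rule nn_integral_cmult) (use gt in measurable)
  also have "emeasure N {(y, z). z < y} = emeasure (P j \<Otimes>\<^sub>M P i) ?G"
  proof -
    have "(\<lambda>(w1, w2). (w1 t, w2 t)) -` {(y, z). z < y} \<inter> space (P j \<Otimes>\<^sub>M P i) = ?G"
      by auto
    then show ?thesis
      unfolding Nd using gt by (subst emeasure_distr) simp_all
  qed
  also have "\<dots> = ennreal (Q.prob ?G)"
    by (rule Q.emeasure_eq_measure)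
  \<comment> \<open>Ties belong to neither event, hence an inequality.\<close>
  also have "ennreal c * \<dots> \<le> ennreal c * ennreal (1 - Q.prob ?L)"
  proof (intro mult_left_mono ennreal_leI)
    have "Q.prob ?G \<le> Q.prob (space (P j \<Otimes>\<^sub>M P i) - ?L)"
      by (rule Q.finite_measure_mono) (use L in auto)
    then show "Q.prob ?G \<le> 1 - Q.prob ?L"
      using Q.prob_compl[OF L] by simp
  qed simp
  finally show ?thesis
    unfolding c_def[symmetric] using c by (simp flip: ennreal_mult')
qed

text \<open>An inversion \<open>i < j\<close>, \<open>\<sigma> j < \<sigma> i\<close> sets two
  requirements against each other: absence of collision keeps the \<open>i\<close>-th path below the
  \<open>j\<close>-th, while under the changed parameters (AO) drives it above.\<close>

lemma ratio_no_collision_tendsto_zero: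
  assumes \<sigma>: "\<sigma> permutes UNIV" and "\<sigma> \<noteq> id"
  shows "((\<lambda>t. \<integral>\<omega>. indicator (space M - collided t) \<omega> * ratio \<sigma> t \<omega> \<partial>M) \<longlongrightarrow> 0) at_top"
proof -
  obtain i j where ij: "i < j" "\<sigma> j < \<sigma> i" using permutes_ex_inversion[OF assms] by blast
  have xE: "x $ k \<in> einterval l r" for k using x_chamber by (simp add: weyl_chamber_def)
  have "\<exists>P. doob_path_law l r a b p \<psi> (lam (\<sigma> k)) (x $ k) P" for k
    using diffusions_exist lam_nonneg xE by blast
  then obtain P where P: "\<And>k. doob_path_law l r a b p \<psi> (lam (\<sigma> k)) (x $ k) (P k)" by metis
  define c where "c = (\<Prod>k\<in>UNIV. \<psi> (lam (\<sigma> k)) (x $ k) / \<psi> (lam k) (x $ k))"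
  have c: "0 < c"
    unfolding c_def using psi_pos lam_nonneg xE
    by (intro prod_pos ballI divide_pos_pos) auto
  define m where "m t = measure (P j \<Otimes>\<^sub>M P i) {(w1, w2) \<in> space (P j \<Otimes>\<^sub>M P i). w1 t < w2 t}" for t
  \<comment> \<open>(AO) for the parameters \<open>lam (\<sigma> j) < lam (\<sigma> i)\<close>, with
    starting points in the opposite order, \<open>x $ j > x $ i\<close>.\<close>
  have "(m \<longlongrightarrow> 1) at_top"
    using AO P[of j] P[of i] xE lam_nonneg lam_mono ij(2)
    unfolding condition_AO_def m_def by (meson strict_monoD)
  then have "((\<lambda>t. c * (1 - m t)) \<longlongrightarrow> c * (1 - 1)) at_top"
    by (intro tendsto_intros)
  then have lim: "((\<lambda>t. c * (1 - m t)) \<longlongrightarrow> 0) at_top" by simp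
  have bound: "0 \<le> (\<integral>\<omega>. indicator (space M - collided t) \<omega> * ratio \<sigma> t \<omega> \<partial>M) \<and>
      (\<integral>\<omega>. indicator (space M - collided t) \<omega> * ratio \<sigma> t \<omega> \<partial>M) \<le> c * (1 - m t)" if t: "0 < t" for t
  proof
    have [measurable]: "collided t \<in> sets M" using collided_in_past[of t t] sets_past_subset t by auto
    have [measurable]: "ratio \<sigma> t \<in> borel_measurable M" using measurable_ratio t by simp
    have pos: "0 \<le> ratio \<sigma> t \<omega>" if "\<omega> \<in> space M" for \<omega>
      using ratio_pos[of t \<omega> \<sigma>] t that by simp
    then show "0 \<le> (\<integral>\<omega>. indicator (space M - collided t) \<omega> * ratio \<sigma> t \<omega> \<partial>M)"
      by (intro integral_nonneg_AE AE_I2) auto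
    interpret Q: prob_space "P j \<Otimes>\<^sub>M P i"
      by (intro prob_space_pair)
         (use P in \<open>auto simp: doob_path_law_def doob_diffusion_def diffusion_def markov_process_def\<close>)
    have m1: "0 \<le> c * (1 - m t)"
      unfolding m_def using c Q.prob_le_1 by (intro mult_nonneg_nonneg) auto
    have "(\<integral>\<omega>. indicator (space M - collided t) \<omega> * ratio \<sigma> t \<omega> \<partial>M) =
        enn2real (\<integral>\<^sup>+\<omega>. ennreal (indicator (space M - collided t) \<omega> * ratio \<sigma> t \<omega>) \<partial>M)"
      using pos by (intro integral_eq_nn_integral AE_I2) auto
    also have "\<dots> \<le> enn2real (ennreal (c * (1 - m t)))"
    proof (rule enn2real_mono)
      have "(\<integral>\<^sup>+\<omega>. ennreal (indicator (space M - collided t) \<omega> * ratio \<sigma> t \<omega>) \<partial>M) \<le>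
          (\<integral>\<^sup>+\<omega>. indicator {\<omega>\<in>space M. X i t \<omega> < X j t \<omega>} \<omega> * ennreal (ratio \<sigma> t \<omega>) \<partial>M)"
      proof (rule nn_integral_mono)
        fix \<omega> assume "\<omega> \<in> space M"
        moreover have "X i t \<omega> < X j t \<omega>" if "\<omega> \<notin> collided t" "\<omega> \<in> space M"
        proof (rule ccontr)
          assume "\<not> X i t \<omega> < X j t \<omega>"
          then have "\<exists>v\<in>{0..t}. 0 \<le> X i v \<omega> - X j v \<omega>" using t by (intro bexI[of _ t]) auto
          with ij(1) that show False by (auto simp: collided_def)
        qed
        ultimately show "ennreal (indicator (space M - collided t) \<omega> * ratio \<sigma> t \<omega>) \<le>
            indicator {\<omega>\<in>space M. X i t \<omega> < X j t \<omega>} \<omega> * ennreal (ratio \<sigma> t \<omega>)"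
          by (auto simp: indicator_def)
      qed
      also have "\<dots> \<le> ennreal (c * (1 - m t))"
        unfolding c_def m_def by (rule ratio_inversion_bound[OF \<sigma> P t]) (use ij in auto)
      finally show "(\<integral>\<^sup>+\<omega>. ennreal (indicator (space M - collided t) \<omega> * ratio \<sigma> t \<omega>) \<partial>M) \<le> ennreal (c * (1 - m t))" .
    qed simp
    also have "\<dots> = c * (1 - m t)" using m1 by simp
    finally show "(\<integral>\<omega>. indicator (space M - collided t) \<omega> * ratio \<sigma> t \<omega> \<partial>M) \<le> c * (1 - m t)" .
  qed
  show ?thesis
    by (rule tendsto_sandwich[OF _ _ tendsto_const lim];
        rule eventually_mono[OF eventually_gt_at_top[of 0]]) (use bound in auto)
qed

section \<open>The probability of no collision\<close>

text \<open>The infimum is infinite exactly when no exit time exists, and since collisions persist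
  in \<open>collided\<close>, integer horizons detect them all. \<open>Suc\<close> keeps the
  horizons positive, as required by \<open>det_quotient_integral_no_collision\<close>.\<close>

lemma collision_time_infinite:
  "{\<omega>\<in>space M. collision_time l r X \<omega> = \<infinity>} = (\<Inter>n. space M - collided (real (Suc n)))"
proof -
  have "collision_time l r X \<omega> = \<infinity> \<longleftrightarrow> (\<forall>n. \<omega> \<notin> collided (real (Suc n)))" if \<omega>: "\<omega> \<in> space M" for \<omega>
  proof -
    have out: "(\<chi> i. X i t \<omega>) \<notin> weyl_chamber l r \<longleftrightarrow> (\<exists>i j. i < j \<and> 0 \<le> X i t \<omega> - X j t \<omega>)"
      if "0 \<le> t" for t
      using X_range[OF \<omega> that] by (auto simp: weyl_chamber_def not_less)
    have "collision_time l r X \<omega> = \<infinity> \<longleftrightarrow> \<not> (\<exists>t\<ge>0. (\<chi> i. X i t \<omega>) \<notin> weyl_chamber l r)"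
    proof
      assume inf: "collision_time l r X \<omega> = \<infinity>"
      show "\<not> (\<exists>t\<ge>0. (\<chi> i. X i t \<omega>) \<notin> weyl_chamber l r)"
      proof
        assume "\<exists>t\<ge>0. (\<chi> i. X i t \<omega>) \<notin> weyl_chamber l r"
        then obtain t where "0 \<le> t" "(\<chi> i. X i t \<omega>) \<notin> weyl_chamber l r" by blast
        then have "collision_time l r X \<omega> \<le> ereal t"
          unfolding collision_time_def by (intro Inf_lower) blast
        with inf show False by simp
      qed
    next
      assume "\<not> (\<exists>t\<ge>0. (\<chi> i. X i t \<omega>) \<notin> weyl_chamber l r)"
      then have "{ereal t |t. 0 \<le> t \<and> (\<chi> i. X i t \<omega>) \<notin> weyl_chamber l r} = {}" by blast
      then show "collision_time l r X \<omega> = \<infinity>"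
        unfolding collision_time_def by (metis Inf_empty top_ereal_def)
    qed
    also have "\<dots> \<longleftrightarrow> (\<forall>n. \<omega> \<notin> collided (real (Suc n)))"
    proof
      assume "\<not> (\<exists>t\<ge>0. (\<chi> i. X i t \<omega>) \<notin> weyl_chamber l r)"
      with out show "\<forall>n. \<omega> \<notin> collided (real (Suc n))" by (fastforce simp: collided_def)
    next
      assume no: "\<forall>n. \<omega> \<notin> collided (real (Suc n))"
      show "\<not> (\<exists>t\<ge>0. (\<chi> i. X i t \<omega>) \<notin> weyl_chamber l r)"
      proof
        assume "\<exists>t\<ge>0. (\<chi> i. X i t \<omega>) \<notin> weyl_chamber l r"
        then obtain t i j where "0 \<le> t" "i < j" "0 \<le> X i t \<omega> - X j t \<omega>" using out by blast
        moreover obtain n where "t \<le> real n" using real_arch_simple by blast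
        ultimately have "\<exists>v\<in>{0..real (Suc n)}. 0 \<le> X i v \<omega> - X j v \<omega>"
          by (intro bexI[of _ t]) auto
        with \<omega> \<open>i < j\<close> have "\<omega> \<in> collided (real (Suc n))"
          unfolding collided_def by blast
        with no show False by blast
      qed
    qed
    finally show ?thesis .
  qed
  then show ?thesis by auto
qed

lemma prob_no_collision:
  "measure M {\<omega>\<in>space M. collision_time l r X \<omega> = \<infinity>} =
    det (\<chi> i j. \<psi> (lam i) (x $ j)) / (\<Prod>i\<in>UNIV. \<psi> (lam i) (x $ i))" (is "_ = ?D")
proof -
  define t where "t n = real (Suc n)" for n
  have t: "0 < t n" for n by (simp add: t_def)
  have t_lim: "filterlim t at_top sequentially"
    unfolding t_def by (rule filterlim_compose[OF filterlim_real_sequentially filterlim_Suc])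
  have collided_M[measurable]: "collided (t n) \<in> sets M" for n using collided_in_past[of "t n" "t n"] sets_past_subset t[of n] by auto
  define e where "e \<sigma> n = (\<integral>\<omega>. indicator (space M - collided (t n)) \<omega> * ratio \<sigma> (t n) \<omega> \<partial>M)" for \<sigma> n
  \<comment> \<open>The left side does not depend on \<open>n\<close>, so the limit may be taken
    term by term in this finite sum.\<close>
  have D: "?D = (\<Sum>\<sigma> | \<sigma> permutes UNIV. of_int (sign \<sigma>) * e \<sigma> n)" for n
    unfolding e_def det_quotient_integral_no_collision[OF t[of n], symmetric]
    by (rule det_quotient_integral_indicator) (use t[of n] in auto)
  let ?m = "measure M {\<omega>\<in>space M. collision_time l r X \<omega> = \<infinity>}"
  have e_id: "e id n = measure M (space M - collided (t n))" for n
  proof -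
    have "ratio id (t n) \<omega> = 1" if "\<omega> \<in> space M" for \<omega>
    proof -
      have "\<psi> (lam k) (X k (t n) \<omega>) \<noteq> 0" for k
        by (intro less_imp_neq[symmetric] psi_pos X_range less_imp_le[OF t] lam_nonneg[rule_format] that)
      then show ?thesis by (simp add: ratio_def)
    qed
    then have "e id n = (\<integral>\<omega>. indicator (space M - collided (t n)) \<omega> \<partial>M)"
      unfolding e_def by (intro Bochner_Integration.integral_cong) auto
    then show ?thesis by (simp add: Int_absorb2)
  qed
  have "(\<lambda>n. measure M (space M - collided (t n))) \<longlonglongrightarrow> measure M (\<Inter>n. space M - collided (t n))"
  proof (rule finite_Lim_measure_decseq)
    have "collided (t m) \<subseteq> collided (t n)" if "m \<le> n" for m n
      by (rule collided_mono) (use that in \<open>simp add: t_def\<close>)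
    then show "decseq (\<lambda>n. space M - collided (t n))"
      unfolding decseq_def by blast
  qed auto
  then have lim_id: "(\<lambda>n. of_int (sign id) * e id n) \<longlonglongrightarrow> ?m"
    by (simp add: e_id collision_time_infinite t_def)
  have lim: "(\<lambda>n. of_int (sign \<sigma>) * e \<sigma> n) \<longlonglongrightarrow> (if \<sigma> = id then ?m else 0)" if "\<sigma> permutes UNIV" for \<sigma>
  proof (cases "\<sigma> = id")
    case False
    from filterlim_compose[OF ratio_no_collision_tendsto_zero[OF that False] t_lim]
    have "e \<sigma> \<longlonglongrightarrow> 0" by (simp add: e_def[abs_def])
    from tendsto_mult_right_zero[OF this] False show ?thesis by simp
  qed (use lim_id in simp)
  have "(\<lambda>n. \<Sum>\<sigma> | \<sigma> permutes UNIV. of_int (sign \<sigma>) * e \<sigma> n) \<longlonglongrightarrow>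
      (\<Sum>\<sigma> | \<sigma> permutes (UNIV :: 'n set). if \<sigma> = id then ?m else 0)"
    by (intro tendsto_sum lim) auto
  then have "(\<lambda>n. ?D) \<longlonglongrightarrow> (\<Sum>\<sigma> | \<sigma> permutes (UNIV :: 'n set). if \<sigma> = id then ?m else 0)"
    unfolding D[symmetric] .
  also have "(\<Sum>\<sigma> | \<sigma> permutes (UNIV :: 'n set). if \<sigma> = id then ?m else 0) = ?m"
    by (subst sum.delta) (auto simp: permutes_id)
  finally show ?thesis by (simp add: LIMSEQ_const_iff)
qed

end

theorem proposition3p1:
  fixes l r :: ereal
    and a b :: "real \<Rightarrow> real"
    and p :: "real \<Rightarrow> real \<Rightarrow> real \<Rightarrow> real"
    and \<psi> :: "real \<Rightarrow> real \<Rightarrow> real"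
    and lam :: "'n::{finite,linorder} \<Rightarrow> real"
    and x :: "real ^ 'n::{finite,linorder}"
    and M :: "'w measure"
    and X :: "'n \<Rightarrow> real \<Rightarrow> 'w \<Rightarrow> real"
  assumes "l < r"
    and "smooth_on (einterval l r) a" and "smooth_on (einterval l r) b"
    and "\<forall>y\<in>einterval l r. 0 < a y"
    and "inaccessible_boundaries l r a b"
    and "transition_density l r a b p"
    and "\<forall>y\<in>einterval l r. \<psi> 0 y = 1"
    and "\<forall>\<mu>>0. increasing_eigenfunction l r a b \<mu> (\<psi> \<mu>)"
    and diffusions_exist: "\<forall>\<mu>\<ge>0. \<forall>y\<in>einterval l r. \<exists>P. doob_path_law l r a b p \<psi> \<mu> y P"
    and "condition_BC l r a b \<psi>"
    and "condition_AO l r a b p \<psi>"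
    and "\<forall>i. 0 \<le> lam i" and "strict_mono lam"
    and "x \<in> weyl_chamber l r"
    and "prob_space M"
    and "\<forall>i. doob_diffusion l r a b p \<psi> (lam i) M (X i) (x $ i)"
    and independent: "prob_space.indep_vars M (\<lambda>i. \<Pi>\<^sub>M t\<in>{0..}. borel)
           (\<lambda>i \<omega>. \<lambda>t\<in>{0..}. X i t \<omega>) UNIV"
  shows "measure M {\<omega>\<in>space M. collision_time l r X \<omega> = \<infinity>} =
         det (\<chi> i j. \<psi> (lam i) (x $ j)) / (\<Prod>i\<in>UNIV. \<psi> (lam i) (x $ i))"
proof -
  interpret prob_space M by fact
  interpret noncolliding_doob_diffusions l r a b p \<psi> M lam x X
    by unfold_locales fact+
  show ?thesis by (rule prob_no_collision)
qed

end
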